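(* Let $\omega:\mathbb{C}\to\mathbb{R}$ be an arbitrary smooth function, $g\in\mathbb{N}$, $\gamma\in\mathbb{S}^1$, and suppose that $$\Phi_\lambda(z)=\frac{\lambda^{-1}}{4}\begin{pmatrix}0&ie^{\omega}\\ 0&0\end{pmatrix}+\sum_{n=0}^{g}\lambda^n\begin{pmatrix}u_n(z)&e^{\omega}\tau_n(z)\\ e^{\omega}\sigma_n(z)&-u_n(z)\end{pmatrix},$$ with functions $u_n,\tau_n,\sigma_n:\mathbb{C}\to\mathbb{C}$, solves the Lax equation $d\Phi_\lambda=[\Phi_\lambda,\alpha(\omega)]$, where $$\alpha(\omega)=\frac14\begin{pmatrix}2\omega_z & i\lambda^{-1} e^{\omega}\\ i\gamma e^{-\omega} & -2\omega_z\end{pmatrix}dz+\frac14\begin{pmatrix}-2\omega_{\bar z} & i\bar\gamma e^{-\omega}\\ i\lambda e^{\omega} & 2\omega_{\bar z}\end{pmatrix}d\bar z .$$ Then: (1) The function $\omega$ is a solution of the sinh-Gordon equation $\Delta\omega+\sinh(\omega)\cosh(\omega)=0$. (2) The functions $u_n$ are solutions of the linearized sinh-Gordon equation $\Delta u+u\cosh(2\omega)=0$. (3) The following iteration gives a formal solution of $d\Phi_\lambda=[\Phi_\lambda,\alpha(\omega)]$. Let $u_n,\sigma_n,\tau_{n-1}$, with $u_n$ a solution of the linearized sinh-Gordon equation, be given. Solve the system $$\tau_{n;\bar z}=\tfrac12 i\bar\gamma e^{-2\omega}u_n,\qquad \tau_{n;z}=4i\bar\gamma\,\omega_z u_{n;z}-2i\bar\gamma\,u_{n;zz}$$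 for $\tau_{n}$. Then define $u_{n+1}$ and $\sigma_{n+1}$ by $$u_{n+1}=-2i\tau_{n;z}-4i\omega_z\tau_n,\qquad \sigma_{n+1}=\gamma e^{2\omega}\tau_n+4i\gamma\,u_{n+1;\bar z}.$$ (4) Each $\tau_n$ is defined (by the iteration in (3)) up to a complex constant $c_n$, so $u_{n+1}$ is defined up to $-4ic_n\omega_z$. (5) $u_0=\omega_z$, $u_{g-1}=c\,\omega_{\bar z}$ for some $c\in\mathbb{C}$, and $\lambda^{g}\,\overline{\Phi_{1/\bar\lambda}}^{\,t}$ also solves the Lax equation $d\Phi_\lambda=[\Phi_\lambda,\alpha(\omega)]$.
   Context: $\Delta=\partial_x^2+\partial_y^2$, $z=x+iy$; subscripts $;z$ and $;\bar z$ denote partial derivatives $\partial_z,\partial_{\bar z}$. Coefficients with index outside the displayed range are understood as $u_{-1}=\sigma_{-1}=0$ and $\tau_{-1}=i/4$ (the coefficient of $\lambda^{-1}$), and $u_n=\sigma_n=\tau_n=0$ for $n>g$. A "formal solution" is a formal series in $\lambda$ of the same shape as $\Phi_\lambda$, but with the sum over all $n\ge 0$, satisfying the Lax equation coefficientwise. The Lax equation is required for all $\lambda\in\mathbb{C}^\times$. *)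

theory Defs
  imports "HOL-Analysis.Analysis"
begin

section \<open>Smooth functions and Wirtinger derivatives on the complex plane\<close>

definition dx :: "(complex \<Rightarrow> 'a::real_normed_vector) \<Rightarrow> complex \<Rightarrow> 'a" where
  "dx f z = frechet_derivative f (at z) 1"

definition dy :: "(complex \<Rightarrow> 'a::real_normed_vector) \<Rightarrow> complex \<Rightarrow> 'a" where
  "dy f z = frechet_derivative f (at z) \<i>"

text \<open>Differentiability is always real differentiability, never complex differentiability.\<close>

fun C_k :: "nat \<Rightarrow> (complex \<Rightarrow> 'a::real_normed_vector) \<Rightarrow> bool" where
  "C_k 0 f \<longleftrightarrow> continuous_on UNIV f"
| "C_k (Suc k) f \<longleftrightarrow> (\<forall>z. f differentiable at z) \<and> C_k k (dx f) \<and> C_k k (dy f)"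

definition smooth :: "(complex \<Rightarrow> 'a::real_normed_vector) \<Rightarrow> bool" where
  "smooth f \<longleftrightarrow> (\<forall>k. C_k k f)"

definition laplacian :: "(complex \<Rightarrow> 'a::real_normed_vector) \<Rightarrow> complex \<Rightarrow> 'a" where
  "laplacian f z = dx (dx f) z + dy (dy f) z"

definition dz :: "(complex \<Rightarrow> complex) \<Rightarrow> complex \<Rightarrow> complex" where
  "dz f z = (dx f z - \<i> * dy f z) / 2"

definition dzbar :: "(complex \<Rightarrow> complex) \<Rightarrow> complex \<Rightarrow> complex" where
  "dzbar f z = (dx f z + \<i> * dy f z) / 2"

definition omega_z :: "(complex \<Rightarrow> real) \<Rightarrow> complex \<Rightarrow> complex" where
  "omega_z \<omega> = dz (\<lambda>z. complex_of_real (\<omega> z))"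

definition omega_zbar :: "(complex \<Rightarrow> real) \<Rightarrow> complex \<Rightarrow> complex" where
  "omega_zbar \<omega> = dzbar (\<lambda>z. complex_of_real (\<omega> z))"

section \<open>The sinh-Gordon equation and its linearization\<close>

definition sinh_gordon :: "(complex \<Rightarrow> real) \<Rightarrow> bool" where
  "sinh_gordon \<omega> \<longleftrightarrow>
     smooth \<omega> \<and> (\<forall>z. laplacian \<omega> z + sinh (\<omega> z) * cosh (\<omega> z) = 0)"

definition linearized_sinh_gordon :: "(complex \<Rightarrow> real) \<Rightarrow> (complex \<Rightarrow> complex) \<Rightarrow> bool" where
  "linearized_sinh_gordon \<omega> u \<longleftrightarrow>
     smooth u \<and> (\<forall>z. laplacian u z + u z * complex_of_real (cosh (2 * \<omega> z)) = 0)"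

section \<open>The Lax equation\<close>

definition mat2 :: "complex \<Rightarrow> complex \<Rightarrow> complex \<Rightarrow> complex \<Rightarrow> complex^2^2" where
  "mat2 a b c d = vector [vector [a, b], vector [c, d]]"

definition cscale :: "complex \<Rightarrow> complex^2^2 \<Rightarrow> complex^2^2" where
  "cscale c = map_matrix (\<lambda>x. c * x)"

definition commutator :: "complex^2^2 \<Rightarrow> complex^2^2 \<Rightarrow> complex^2^2" where
  "commutator A B = A ** B - B ** A"

definition e_pow :: "real \<Rightarrow> complex" where
  "e_pow x = complex_of_real (exp x)"

text \<open>
  A matrix-valued 1-form at a point is a function of the tangent vector h, with the values
  h and cnj h of the forms written dz and d(z bar) in the mathematics.
\<close>

definition alpha :: "complex \<Rightarrow> (complex \<Rightarrow> real) \<Rightarrow> complex \<Rightarrow> complex \<Rightarrow> complex \<Rightarrow> complex^2^2" where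
  "alpha \<gamma> \<omega> l z h =
     cscale (1/4 * h)
       (mat2 (2 * omega_z \<omega> z) (\<i> * inverse l * e_pow (\<omega> z))
             (\<i> * \<gamma> * e_pow (- \<omega> z)) (- 2 * omega_z \<omega> z)) +
     cscale (1/4 * cnj h)
       (mat2 (- 2 * omega_zbar \<omega> z) (\<i> * cnj \<gamma> * e_pow (- \<omega> z))
             (\<i> * l * e_pow (\<omega> z)) (2 * omega_zbar \<omega> z))"

definition lax_solution ::
    "complex \<Rightarrow> (complex \<Rightarrow> real) \<Rightarrow> (complex \<Rightarrow> complex \<Rightarrow> complex^2^2) \<Rightarrow> bool" where
  "lax_solution \<gamma> \<omega> \<Phi> \<longleftrightarrow>
     (\<forall>l z. l \<noteq> 0 \<longrightarrow>
        (\<Phi> l has_derivative (\<lambda>h. commutator (\<Phi> l z) (alpha \<gamma> \<omega> l z h))) (at z))"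

section \<open>Polynomial and formal solutions\<close>

definition Phi_coeff ::
    "(complex \<Rightarrow> real) \<Rightarrow> (int \<Rightarrow> complex \<Rightarrow> complex) \<Rightarrow> (int \<Rightarrow> complex \<Rightarrow> complex) \<Rightarrow>
     (int \<Rightarrow> complex \<Rightarrow> complex) \<Rightarrow> int \<Rightarrow> complex \<Rightarrow> complex^2^2" where
  "Phi_coeff \<omega> u \<tau> \<sigma> n z =
     mat2 (u n z) (e_pow (\<omega> z) * \<tau> n z) (e_pow (\<omega> z) * \<sigma> n z) (- u n z)"

definition Phi ::
    "nat \<Rightarrow> (complex \<Rightarrow> real) \<Rightarrow> (int \<Rightarrow> complex \<Rightarrow> complex) \<Rightarrow> (int \<Rightarrow> complex \<Rightarrow> complex) \<Rightarrow>
     (int \<Rightarrow> complex \<Rightarrow> complex) \<Rightarrow> complex \<Rightarrow> complex \<Rightarrow> complex^2^2" where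
  "Phi g \<omega> u \<tau> \<sigma> l z =
     cscale (inverse l / 4) (mat2 0 (\<i> * e_pow (\<omega> z)) 0 0) +
     (\<Sum>n = 0..g. cscale (l ^ n) (Phi_coeff \<omega> u \<tau> \<sigma> (int n) z))"

text \<open>
  Coefficients are indexed by all integers. The first predicate fixes the values at negative
  indices, so that the leading term of \<open>Phi\<close> is the coefficient at index -1; the second
  additionally truncates above g.
\<close>

definition formal_shape ::
    "(int \<Rightarrow> complex \<Rightarrow> complex) \<Rightarrow> (int \<Rightarrow> complex \<Rightarrow> complex) \<Rightarrow> (int \<Rightarrow> complex \<Rightarrow> complex) \<Rightarrow> bool" where
  "formal_shape u \<tau> \<sigma> \<longleftrightarrow>
     (\<forall>n<0. u n = (\<lambda>z. 0) \<and> \<sigma> n = (\<lambda>z. 0)) \<and>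
     \<tau> (-1) = (\<lambda>z. \<i> / 4) \<and> (\<forall>n< -1. \<tau> n = (\<lambda>z. 0))"

definition polynomial_shape ::
    "nat \<Rightarrow> (int \<Rightarrow> complex \<Rightarrow> complex) \<Rightarrow> (int \<Rightarrow> complex \<Rightarrow> complex) \<Rightarrow>
     (int \<Rightarrow> complex \<Rightarrow> complex) \<Rightarrow> bool" where
  "polynomial_shape g u \<tau> \<sigma> \<longleftrightarrow> formal_shape u \<tau> \<sigma> \<and>
     (\<forall>n>int g. u n = (\<lambda>z. 0) \<and> \<tau> n = (\<lambda>z. 0) \<and> \<sigma> n = (\<lambda>z. 0))"

text \<open>The coefficient of the j-th power of the spectral parameter in \<open>alpha\<close>.\<close>

definition alpha_coeff ::
    "complex \<Rightarrow> (complex \<Rightarrow> real) \<Rightarrow> int \<Rightarrow> complex \<Rightarrow> complex \<Rightarrow> complex^2^2" where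
  "alpha_coeff \<gamma> \<omega> j z h =
     (if j = -1 then cscale (1/4 * h) (mat2 0 (\<i> * e_pow (\<omega> z)) 0 0)
      else if j = 0 then
        cscale (1/4 * h)
          (mat2 (2 * omega_z \<omega> z) 0 (\<i> * \<gamma> * e_pow (- \<omega> z)) (- 2 * omega_z \<omega> z)) +
        cscale (1/4 * cnj h)
          (mat2 (- 2 * omega_zbar \<omega> z) (\<i> * cnj \<gamma> * e_pow (- \<omega> z)) 0 (2 * omega_zbar \<omega> z))
      else if j = 1 then cscale (1/4 * cnj h) (mat2 0 0 (\<i> * e_pow (\<omega> z)) 0)
      else 0)"

lemma alpha_eq_sum_alpha_coeff:
  "alpha \<gamma> \<omega> l z h = (\<Sum>j\<in>{-1, 0, 1}. cscale (l powi j) (alpha_coeff \<gamma> \<omega> j z h))"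
  by (simp add: alpha_def alpha_coeff_def cscale_def mat2_def vec_eq_iff forall_2
      power_int_minus algebra_simps)

text \<open>The Lax equation for a formal series, compared at every power of the spectral parameter.\<close>

definition formal_solution ::
    "complex \<Rightarrow> (complex \<Rightarrow> real) \<Rightarrow> (int \<Rightarrow> complex \<Rightarrow> complex) \<Rightarrow>
     (int \<Rightarrow> complex \<Rightarrow> complex) \<Rightarrow> (int \<Rightarrow> complex \<Rightarrow> complex) \<Rightarrow> bool" where
  "formal_solution \<gamma> \<omega> u \<tau> \<sigma> \<longleftrightarrow> formal_shape u \<tau> \<sigma> \<and>
     (\<forall>k z. (Phi_coeff \<omega> u \<tau> \<sigma> k has_derivative
        (\<lambda>h. \<Sum>j\<in>{-1, 0, 1}.
           commutator (Phi_coeff \<omega> u \<tau> \<sigma> (k - j) z) (alpha_coeff \<gamma> \<omega> j z h))) (at z))"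

section \<open>The iteration\<close>

definition tau_system ::
    "complex \<Rightarrow> (complex \<Rightarrow> real) \<Rightarrow> (complex \<Rightarrow> complex) \<Rightarrow> (complex \<Rightarrow> complex) \<Rightarrow> bool" where
  "tau_system \<gamma> \<omega> u \<tau> \<longleftrightarrow>
     (\<forall>z. \<tau> differentiable at z \<and>
        dzbar \<tau> z = 1/2 * \<i> * cnj \<gamma> * e_pow (- 2 * \<omega> z) * u z \<and>
        dz \<tau> z = 4 * \<i> * cnj \<gamma> * omega_z \<omega> z * dz u z - 2 * \<i> * cnj \<gamma> * dz (dz u) z)"

definition next_u :: "(complex \<Rightarrow> real) \<Rightarrow> (complex \<Rightarrow> complex) \<Rightarrow> complex \<Rightarrow> complex" where
  "next_u \<omega> \<tau> z = - 2 * \<i> * dz \<tau> z - 4 * \<i> * omega_z \<omega> z * \<tau> z"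

definition next_sigma ::
    "complex \<Rightarrow> (complex \<Rightarrow> real) \<Rightarrow> (complex \<Rightarrow> complex) \<Rightarrow> (complex \<Rightarrow> complex) \<Rightarrow> complex \<Rightarrow> complex" where
  "next_sigma \<gamma> \<omega> \<tau> u' z = \<gamma> * e_pow (2 * \<omega> z) * \<tau> z + 4 * \<i> * \<gamma> * dzbar u' z"

definition iteration_step ::
    "complex \<Rightarrow> (complex \<Rightarrow> real) \<Rightarrow> (int \<Rightarrow> complex \<Rightarrow> complex) \<Rightarrow>
     (int \<Rightarrow> complex \<Rightarrow> complex) \<Rightarrow> (int \<Rightarrow> complex \<Rightarrow> complex) \<Rightarrow> int \<Rightarrow> bool" where
  "iteration_step \<gamma> \<omega> u \<tau> \<sigma> n \<longleftrightarrow>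
     tau_system \<gamma> \<omega> (u n) (\<tau> n) \<and>
     u (n + 1) = next_u \<omega> (\<tau> n) \<and>
     \<sigma> (n + 1) = next_sigma \<gamma> \<omega> (\<tau> n) (u (n + 1))"

end

theory Submission
  imports Defs
begin

text \<open>
  Comparing powers of the spectral parameter turns the Lax equation into a recursion that
  expresses both Wirtinger derivatives of the coefficients with index n through coefficients
  with index n - 1, n and n + 1. In particular the coefficients are smooth by bootstrapping, and
  cross differentiation gives the linearized sinh-Gordon equation for every u n. At n = -1 the
  recursion forces u 0 to be the z-derivative of omega, and the equation for u 0 is then the
  sinh-Gordon equation. Conversely, the system for tau n is closed exactly because u n solves
  the linearized equation, so it can be integrated on the plane, and substituting its solution
  into the definitions of u (n + 1) and sigma (n + 1) yields the remaining equations of the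
  recursion.
\<close>

section \<open>Calculus in Wirtinger derivatives\<close>

text \<open>The recursion is overdetermined: \<open>\<sigma> (n + 1)\<close> occurs in the
  z-derivative of \<open>u n\<close> and again in the zbar-derivative of \<open>u (n + 1)\<close>.
  The iteration reads it off the second relation. Solving the first for it, differentiating in z,
  and eliminating \<open>\<sigma> (n + 1)\<close> and \<open>u (n + 1)\<close> leaves exactly the
  z-equation prescribed for \<open>\<tau> n\<close>. The crux of the converse is that both readings
  agree; this uses sinh-Gordon in the form \<open>dzbar (omega_z \<omega>) z = (e_pow (- 2 *
  \<omega> z) - e_pow (2 * \<omega> z)) / 16\<close>, and
  \<open>\<gamma> * cnj \<gamma> = 1\<close>. At the other end of a polynomial solution the zeros
  above g propagate downwards and make \<open>\<sigma> g\<close> constant, which ties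
  \<open>u (g - 1)\<close> to the zbar-derivative of omega.\<close>

definition has_wirtinger :: "(complex \<Rightarrow> complex) \<Rightarrow> complex \<Rightarrow> complex \<Rightarrow> complex \<Rightarrow> bool" where
  "has_wirtinger f p q z \<longleftrightarrow> (f has_derivative (\<lambda>h. p * h + q * cnj h)) (at z)"

lemma has_wirtinger_D:
  assumes "has_wirtinger f p q z"
  shows "f differentiable at z" "dx f z = p + q" "dy f z = \<i> * (p - q)"
    "dz f z = p" "dzbar f z = q"
proof -
  have "frechet_derivative f (at z) = (\<lambda>h. p * h + q * cnj h)"
    using assms frechet_derivative_at unfolding has_wirtinger_def by metis
  then show xy: "dx f z = p + q" "dy f z = \<i> * (p - q)"
    by (simp_all add: dx_def dy_def algebra_simps)
  show "dz f z = p" "dzbar f z = q"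
    by (simp_all add: dz_def dzbar_def xy field_simps)
  show "f differentiable at z"
    using assms unfolding has_wirtinger_def differentiable_def by blast
qed

lemma has_wirtinger_unique:
  assumes "has_wirtinger f p q z" "has_wirtinger f p' q' z"
  shows "p = p'" "q = q'"
  using has_wirtinger_D(4,5)[OF assms(1)] has_wirtinger_D(4,5)[OF assms(2)] by auto

lemma frechet_derivative_eq_dx_dy:
  assumes "f differentiable at z"
  shows "frechet_derivative f (at z) h = Re h *\<^sub>R dx f z + Im h *\<^sub>R dy f z"
proof -
  interpret linear "frechet_derivative f (at z)"
    using assms by (rule linear_frechet_derivative)
  have "h = Re h *\<^sub>R 1 + Im h *\<^sub>R \<i>"
    by (simp add: complex_eq_iff)
  then show ?thesis
    unfolding dx_def dy_def by (metis add scaleR)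
qed

lemma has_derivative_dx_dy:
  assumes "f differentiable at z"
  shows "(f has_derivative (\<lambda>h. Re h *\<^sub>R dx f z + Im h *\<^sub>R dy f z)) (at z)"
  using assms frechet_derivative_eq_dx_dy[OF assms] frechet_derivative_works[of f "at z"]
  by (metis (no_types, lifting) ext)

lemma has_wirtinger_dz_dzbar:
  assumes "f differentiable at z"
  shows "has_wirtinger f (dz f z) (dzbar f z) z"
proof -
  have "Re h *\<^sub>R dx f z + Im h *\<^sub>R dy f z = dz f z * h + dzbar f z * cnj h" for h
    by (simp add: dz_def dzbar_def complex_eq_iff field_simps)
  with has_derivative_dx_dy[OF assms] show ?thesis
    by (simp add: has_wirtinger_def)
qed

text \<open>Differentiability is a separate conjunct because \<open>dz f z\<close> and
  \<open>dzbar f z\<close> have some value even where f is not differentiable.\<close>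

lemma has_wirtinger_iff:
  "has_wirtinger f p q z \<longleftrightarrow> f differentiable at z \<and> dz f z = p \<and> dzbar f z = q"
  by (metis has_wirtinger_D(1,4,5) has_wirtinger_dz_dzbar)

lemma has_wirtinger_eq_rhs:
  "has_wirtinger f p q z \<Longrightarrow> p = p' \<Longrightarrow> q = q' \<Longrightarrow> has_wirtinger f p' q' z"
  by simp

lemma has_wirtinger_const: "has_wirtinger (\<lambda>z. c) 0 0 z"
  by (simp add: has_wirtinger_def)

lemma has_wirtinger_add:
  assumes "has_wirtinger f p q z" "has_wirtinger f' p' q' z"
  shows "has_wirtinger (\<lambda>z. f z + f' z) (p + p') (q + q') z"
  using has_derivative_add[OF assms[unfolded has_wirtinger_def]]
  by (simp add: has_wirtinger_def algebra_simps)

lemma has_wirtinger_mult: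
  assumes "has_wirtinger f p q z" "has_wirtinger f' p' q' z"
  shows "has_wirtinger (\<lambda>z. f z * f' z) (p * f' z + f z * p') (q * f' z + f z * q') z"
  using has_derivative_mult[OF assms[unfolded has_wirtinger_def]]
  by (simp add: has_wirtinger_def algebra_simps)

lemma has_wirtinger_cmult:
  assumes "has_wirtinger f p q z"
  shows "has_wirtinger (\<lambda>z. c * f z) (c * p) (c * q) z"
  using has_wirtinger_mult[OF has_wirtinger_const assms] by simp

lemma has_wirtinger_diff:
  assumes "has_wirtinger f p q z" "has_wirtinger f' p' q' z"
  shows "has_wirtinger (\<lambda>z. f z - f' z) (p - p') (q - q') z"
  using has_wirtinger_add[OF assms(1) has_wirtinger_cmult[OF assms(2), of "-1"]] by simp

lemma has_wirtinger_exp: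
  assumes "has_wirtinger f p q z"
  shows "has_wirtinger (\<lambda>z. exp (f z)) (exp (f z) * p) (exp (f z) * q) z"
proof -
  have "(exp has_derivative (\<lambda>h. exp (f z) * h)) (at (f z))"
    using DERIV_exp has_field_derivative_def by blast
  from has_derivative_compose[OF assms[unfolded has_wirtinger_def] this] show ?thesis
    by (simp add: has_wirtinger_def algebra_simps)
qed

lemmas has_wirtinger_intros =
  has_wirtinger_const has_wirtinger_cmult has_wirtinger_mult has_wirtinger_add has_wirtinger_diff

lemma has_wirtinger_0_imp_constant:
  assumes "\<And>z. has_wirtinger f 0 0 z"
  shows "\<exists>c. f = (\<lambda>z. c)"
proof -
  have "\<exists>c. \<forall>z\<in>UNIV. f z = c"
    by (rule has_derivative_zero_constant) (use assms in \<open>auto simp: has_wirtinger_def\<close>)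
  then show ?thesis by auto
qed

section \<open>Smooth functions\<close>

lemma C_k_continuous: "C_k k f \<Longrightarrow> continuous_on UNIV f"
  by (cases k)
    (auto intro!: continuous_at_imp_continuous_on differentiable_imp_continuous_within)

lemma C_k_Suc_imp: "C_k (Suc k) f \<Longrightarrow> C_k k f"
proof (induction k arbitrary: f)
  case 0
  then show ?case using C_k_continuous by (simp only: C_k.simps(1))
next
  case (Suc k)
  then show ?case unfolding C_k.simps(2)[of "Suc k"] C_k.simps(2)[of k f] by blast
qed

lemma smooth_iff: "smooth f \<longleftrightarrow> (\<forall>z. f differentiable at z) \<and> smooth (dx f) \<and> smooth (dy f)"
  unfolding smooth_def by (metis C_k.simps(2) C_k_Suc_imp)

lemma smooth_continuous: "smooth f \<Longrightarrow> continuous_on UNIV f"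
  using C_k_continuous smooth_def by blast

text \<open>The hypotheses concern \<open>p + q\<close> and \<open>\<i> * (p - q)\<close>, that is
  \<open>dx f\<close> and \<open>dy f\<close>, because closure of \<open>C_k\<close> under sums and
  products is itself derived from this rule. Once that is available, \<open>C_k_SucI'\<close> asks
  for p and q directly.\<close>

lemma C_k_SucI:
  assumes "\<And>z. has_wirtinger f (p z) (q z) z" "C_k k (\<lambda>z. p z + q z)" "C_k k (\<lambda>z. \<i> * (p z - q z))"
  shows "C_k (Suc k) f"
proof -
  have "dx f = (\<lambda>z. p z + q z)" "dy f = (\<lambda>z. \<i> * (p z - q z))"
    using has_wirtinger_D(2,3)[OF assms(1)] by auto
  then show ?thesis
    using assms has_wirtinger_D(1)[OF assms(1)] by simp
qed

lemma C_k_const: "C_k k (\<lambda>z. c :: complex)"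
proof (induction k arbitrary: c)
  case (Suc k)
  show ?case
    by (rule C_k_SucI[OF has_wirtinger_const]) (simp_all add: Suc)
qed simp

lemma dx_conv_wirtinger: "dx f z = dz f z + dzbar f z"
  and dy_conv_wirtinger: "dy f z = \<i> * (dz f z - dzbar f z)"
  by (simp_all add: dz_def dzbar_def field_simps)

lemma C_k_add:
  fixes f g :: "complex \<Rightarrow> complex"
  assumes "C_k k f" "C_k k g"
  shows "C_k k (\<lambda>z. f z + g z)"
  using assms
proof (induction k arbitrary: f g)
  case 0
  then show ?case by (auto intro: continuous_intros)
next
  case (Suc k)
  show ?case
  proof (rule C_k_SucI[OF has_wirtinger_add[OF has_wirtinger_dz_dzbar has_wirtinger_dz_dzbar]])
    have "C_k k (\<lambda>z. dx f z + dx g z)" "C_k k (\<lambda>z. dy f z + dy g z)"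
      using Suc by simp_all
    then show "C_k k (\<lambda>z. dz f z + dz g z + (dzbar f z + dzbar g z))"
      "C_k k (\<lambda>z. \<i> * (dz f z + dz g z - (dzbar f z + dzbar g z)))"
      by (simp_all add: dx_conv_wirtinger dy_conv_wirtinger algebra_simps)
  qed (use Suc in simp_all)
qed

lemma C_k_mult:
  fixes f g :: "complex \<Rightarrow> complex"
  assumes "C_k k f" "C_k k g"
  shows "C_k k (\<lambda>z. f z * g z)"
  using assms
proof (induction k arbitrary: f g)
  case 0
  then show ?case by (auto intro: continuous_intros)
next
  case (Suc k)
  note * = Suc.prems[THEN C_k_Suc_imp]
  show ?case
  proof (rule C_k_SucI[OF has_wirtinger_mult[OF has_wirtinger_dz_dzbar has_wirtinger_dz_dzbar]])
    have "C_k k (\<lambda>z. dx f z * g z + f z * dx g z)" "C_k k (\<lambda>z. dy f z * g z + f z * dy g z)"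
      using Suc * by (auto intro!: C_k_add)
    then show "C_k k (\<lambda>z. dz f z * g z + f z * dz g z + (dzbar f z * g z + f z * dzbar g z))"
      "C_k k (\<lambda>z. \<i> * (dz f z * g z + f z * dz g z - (dzbar f z * g z + f z * dzbar g z)))"
      by (simp_all add: dx_conv_wirtinger dy_conv_wirtinger algebra_simps)
  qed (use Suc in simp_all)
qed

lemma C_k_diff:
  fixes f g :: "complex \<Rightarrow> complex"
  assumes "C_k k f" "C_k k g"
  shows "C_k k (\<lambda>z. f z - g z)"
  using C_k_add[OF assms(1) C_k_mult[OF C_k_const[of k "-1"] assms(2)]] by simp

lemma C_k_SucI':
  assumes "\<And>z. has_wirtinger f (p z) (q z) z" "C_k k p" "C_k k q"
  shows "C_k (Suc k) f"
  by (rule C_k_SucI[OF assms(1)]) (intro C_k_add C_k_mult C_k_diff C_k_const assms)+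

lemma C_k_exp: "C_k k f \<Longrightarrow> C_k k (\<lambda>z. exp (f z) :: complex)"
proof (induction k arbitrary: f)
  case 0
  then show ?case by (auto intro: continuous_intros)
next
  case (Suc k)
  note * = C_k_Suc_imp[OF Suc.prems]
  show ?case
  proof (rule C_k_SucI[OF has_wirtinger_exp[OF has_wirtinger_dz_dzbar]])
    have "C_k k (\<lambda>z. exp (f z) * dx f z)" "C_k k (\<lambda>z. exp (f z) * dy f z)"
      using Suc * by (auto intro!: C_k_mult)
    then show "C_k k (\<lambda>z. exp (f z) * dz f z + exp (f z) * dzbar f z)"
      "C_k k (\<lambda>z. \<i> * (exp (f z) * dz f z - exp (f z) * dzbar f z))"
      by (simp_all add: dx_conv_wirtinger dy_conv_wirtinger algebra_simps)
  qed (use Suc in simp_all)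
qed

lemma smooth_const: "smooth (\<lambda>z. c :: complex)"
  and smooth_add: "smooth f \<Longrightarrow> smooth g \<Longrightarrow> smooth (\<lambda>z. f z + g z :: complex)"
  and smooth_diff: "smooth f \<Longrightarrow> smooth g \<Longrightarrow> smooth (\<lambda>z. f z - g z :: complex)"
  and smooth_mult: "smooth f \<Longrightarrow> smooth g \<Longrightarrow> smooth (\<lambda>z. f z * g z :: complex)"
  and smooth_exp: "smooth f \<Longrightarrow> smooth (\<lambda>z. exp (f z) :: complex)"
  by (simp_all add: smooth_def C_k_const C_k_add C_k_diff C_k_mult C_k_exp)

lemmas smooth_intros = smooth_const smooth_add smooth_diff smooth_mult

lemma smooth_dz:
  assumes "smooth f"
  shows "smooth (dz f)" "smooth (dzbar f)"
proof -
  have "dz f = (\<lambda>z. 1/2 * dx f z - \<i>/2 * dy f z)" "dzbar f = (\<lambda>z. 1/2 * dx f z + \<i>/2 * dy f z)"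
    by (auto simp: dz_def dzbar_def field_simps)
  then show "smooth (dz f)" "smooth (dzbar f)"
    using assms smooth_iff[of f] by (simp_all only: smooth_intros)
qed

lemma smooth_has_wirtinger: "smooth f \<Longrightarrow> has_wirtinger f (dz f z) (dzbar f z) z"
  using smooth_iff has_wirtinger_dz_dzbar by blast

lemma smooth_wirtingerI:
  assumes "\<And>z. has_wirtinger f (p z) (q z) z" "smooth p" "smooth q"
  shows "smooth f"
  using assms C_k_SucI' C_k_Suc_imp unfolding smooth_def by meson

lemma dx_of_real:
  assumes "f differentiable at z"
  shows "dx (\<lambda>z. complex_of_real (f z)) z = of_real (dx f z)"
    "dy (\<lambda>z. complex_of_real (f z)) z = of_real (dy f z)"
proof -
  have "((\<lambda>z. complex_of_real (f z)) has_derivative (\<lambda>h. of_real (frechet_derivative f (at z) h))) (at z)"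
    using assms frechet_derivative_works has_derivative_of_real by blast
  then show "dx (\<lambda>z. complex_of_real (f z)) z = of_real (dx f z)"
    "dy (\<lambda>z. complex_of_real (f z)) z = of_real (dy f z)"
    unfolding dx_def dy_def using frechet_derivative_at by (metis)+
qed

lemma smooth_of_real:
  assumes "smooth (f :: complex \<Rightarrow> real)"
  shows "smooth (\<lambda>z. complex_of_real (f z))"
  unfolding smooth_def
proof
  fix k
  have "C_k k f" using assms by (simp add: smooth_def)
  then show "C_k k (\<lambda>z. complex_of_real (f z))"
  proof (induction k arbitrary: f)
    case 0
    then show ?case by (auto intro: continuous_intros)
  next
    case (Suc k)
    have "dx (\<lambda>z. complex_of_real (f z)) = (\<lambda>z. of_real (dx f z))"
      "dy (\<lambda>z. complex_of_real (f z)) = (\<lambda>z. of_real (dy f z))"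
      using Suc.prems dx_of_real by auto
    moreover have "(\<lambda>z. complex_of_real (f z)) differentiable at z" for z
      using Suc.prems has_derivative_of_real unfolding differentiable_def C_k.simps by blast
    ultimately show ?case using Suc by simp
  qed
qed

section \<open>Equality of mixed derivatives and the Poincare lemma on the plane\<close>

lemma has_vector_derivative_horizontal:
  assumes "f differentiable at (Complex x y)"
  shows "((\<lambda>x. f (Complex x y)) has_vector_derivative dx f (Complex x y)) (at x within S)"
proof -
  have "((\<lambda>x. Complex x y) has_derivative (\<lambda>h. of_real h)) (at x within S)"
    unfolding Complex_eq by (auto intro!: derivative_eq_intros)
  from has_derivative_compose[OF this has_derivative_dx_dy[OF assms]]
  show ?thesis by (simp add: has_vector_derivative_def)
qed

lemma has_vector_derivative_vertical:
  assumes "f differentiable at (Complex x y)"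
  shows "((\<lambda>y. f (Complex x y)) has_vector_derivative dy f (Complex x y)) (at y within S)"
proof -
  have "((\<lambda>y. Complex x y) has_derivative (\<lambda>h. \<i> * of_real h)) (at y within S)"
    unfolding Complex_eq by (auto intro!: derivative_eq_intros)
  from has_derivative_compose[OF this has_derivative_dx_dy[OF assms]]
  show ?thesis by (simp add: has_vector_derivative_def)
qed

lemma continuous_on_Complex [continuous_intros]:
  assumes "continuous_on S f" "continuous_on S g"
  shows "continuous_on S (\<lambda>x. Complex (f x) (g x))"
  unfolding Complex_eq using assms by (intro continuous_intros)

text \<open>Differentiate f(x + i y) - f(a + i y), as an integral of dx f, under the integral sign.\<close>

lemma dx_dy_commute:
  fixes f :: "complex \<Rightarrow> complex"
  assumes f: "smooth f"
  shows "dx (dy f) z = dy (dx f) z"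
proof -
  define a b where "a = Re z" and "b = Im z"
  \<comment> \<open>The integral starts at \<open>a - 1\<close> so that a is interior to I; the
    derivative within I is then a derivative at a.\<close>
  define I where "I = {a - 1 .. a + 1}"
  have diff: "f differentiable at w" "dx f differentiable at w" "dy f differentiable at w" for w
    using f smooth_iff by metis+
  have cont': "continuous_on UNIV (dx f)" "continuous_on UNIV (dy (dx f))"
    using f smooth_iff smooth_continuous by metis+
  have cont: "continuous_on S (\<lambda>x. dx f (Complex x y))" for S y
    by (intro continuous_intros continuous_on_compose2[OF cont'(1)]) auto
  have dy_eq: "dy f (Complex x b) =
      dy f (Complex (a - 1) b) + integral {a - 1..x} (\<lambda>s. dy (dx f) (Complex s b))"
    if "x \<in> I" for x
  proof -
    have int: "((\<lambda>s. dx f (Complex s y)) has_integral f (Complex x y) - f (Complex (a - 1) y)) {a - 1..x}" for y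
      using that by (intro fundamental_theorem_of_calculus has_vector_derivative_horizontal diff)
        (auto simp: I_def)
    have "((\<lambda>y. integral (cbox (a - 1) x) (\<lambda>s. dx f (Complex s y))) has_vector_derivative
        integral (cbox (a - 1) x) (\<lambda>s. dy (dx f) (Complex s b))) (at b within UNIV)"
    proof (rule leibniz_rule_vector_derivative)
      show "continuous_on (UNIV \<times> cbox (a - 1) x) (\<lambda>(y, s). dy (dx f) (Complex s y))"
        unfolding split_beta
        by (intro continuous_intros continuous_on_compose2[OF cont'(2)]) auto
    qed (auto intro!: has_vector_derivative_vertical diff cont integrable_continuous_interval)
    moreover have "integral (cbox (a - 1) x) (\<lambda>s. dx f (Complex s y)) =
        f (Complex x y) - f (Complex (a - 1) y)" for y
      using integral_unique[OF int] by (simp only: cbox_interval)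
    ultimately have "((\<lambda>y. f (Complex x y) - f (Complex (a - 1) y)) has_vector_derivative
        integral {a - 1..x} (\<lambda>s. dy (dx f) (Complex s b))) (at b)"
      by (simp only: cbox_interval)
    moreover have "((\<lambda>y. f (Complex x y) - f (Complex (a - 1) y)) has_vector_derivative
        dy f (Complex x b) - dy f (Complex (a - 1) b)) (at b)"
      by (intro has_vector_derivative_diff has_vector_derivative_vertical diff)
    ultimately have "integral {a - 1..x} (\<lambda>s. dy (dx f) (Complex s b)) =
        dy f (Complex x b) - dy f (Complex (a - 1) b)"
      by (rule vector_derivative_unique_at)
    then show ?thesis by simp
  qed
  have "((\<lambda>x. dy f (Complex (a - 1) b) + integral {a - 1..x} (\<lambda>s. dy (dx f) (Complex s b)))
      has_vector_derivative 0 + dy (dx f) (Complex a b)) (at a within I)"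
    unfolding I_def
    by (intro has_vector_derivative_add has_vector_derivative_const integral_has_vector_derivative
        continuous_intros continuous_on_compose2[OF cont'(2)]) auto
  then have "((\<lambda>x. dy f (Complex x b)) has_vector_derivative 0 + dy (dx f) (Complex a b)) (at a within I)"
    by (rule has_vector_derivative_transform[rotated 2]) (simp add: I_def, rule dy_eq)
  moreover have "((\<lambda>x. dy f (Complex x b)) has_vector_derivative dx (dy f) (Complex a b)) (at a within I)"
    by (intro has_vector_derivative_horizontal diff)
  moreover have "at a within I = at a"
    unfolding I_def by (rule at_within_Icc_at) auto
  ultimately show ?thesis
    using vector_derivative_unique_at[of "\<lambda>x. dy f (Complex x b)"] by (simp add: a_def b_def)
qed

lemma dz_dzbar_laplacian:
  fixes f :: "complex \<Rightarrow> complex"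
  assumes "smooth f"
  shows "dz (dzbar f) z = laplacian f z / 4" "dzbar (dz f) z = laplacian f z / 4"
proof -
  have d: "has_wirtinger (dx f) (dz (dx f) z) (dzbar (dx f) z) z"
    "has_wirtinger (dy f) (dz (dy f) z) (dzbar (dy f) z) z"
    using assms smooth_iff smooth_has_wirtinger by metis+
  have eq: "dz f = (\<lambda>z. 1/2 * dx f z - \<i>/2 * dy f z)" "dzbar f = (\<lambda>z. 1/2 * dx f z + \<i>/2 * dy f z)"
    by (auto simp: dz_def dzbar_def field_simps)
  have "has_wirtinger (dz f) (1/2 * dz (dx f) z - \<i>/2 * dz (dy f) z)
      (1/2 * dzbar (dx f) z - \<i>/2 * dzbar (dy f) z) z"
    "has_wirtinger (dzbar f) (1/2 * dz (dx f) z + \<i>/2 * dz (dy f) z)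
      (1/2 * dzbar (dx f) z + \<i>/2 * dzbar (dy f) z) z"
    unfolding eq by (intro has_wirtinger_intros d)+
  note eqs = this(2)[THEN has_wirtinger_D(4)] this(1)[THEN has_wirtinger_D(5)]
  show "dz (dzbar f) z = laplacian f z / 4" "dzbar (dz f) z = laplacian f z / 4"
    unfolding eqs
    by (simp_all add: dz_def[of "dx f"] dz_def[of "dy f"] dzbar_def[of "dx f"] dzbar_def[of "dy f"]
        laplacian_def dx_dy_commute[OF assms] field_simps)
qed


lemma dzbar_dz:
  assumes "smooth f"
  shows "dzbar (dz f) z = dz (dzbar f) z"
  by (simp only: dz_dzbar_laplacian[OF assms])

text \<open>Integrate the form radially: at z take the integral over t in [0, 1] of a(t z) x + b(t z) y.\<close>

lemma smooth_closed_form_exact: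
  fixes a b :: "complex \<Rightarrow> complex"
  assumes a: "smooth a" and b: "smooth b" and closed: "\<And>z. dy a z = dx b z"
  obtains F where "\<And>z. (F has_derivative (\<lambda>h. Re h *\<^sub>R a z + Im h *\<^sub>R b z)) (at z)"
proof -
  \<comment> \<open>The real-linear map with values c at 1 and d at \<open>\<i>\<close>, packaged as
    a bounded linear function so that derivatives can be integrated in the Leibniz rule.\<close>
  define L where
    "L c d = (blinfun_scaleR_left c o\<^sub>L Blinfun Re) + (blinfun_scaleR_left d o\<^sub>L Blinfun Im)"
    for c d :: complex
  have L: "blinfun_apply (L c d) h = Re h *\<^sub>R c + Im h *\<^sub>R d" for c d h
    by (simp add: L_def plus_blinfun.rep_eq bounded_linear_Blinfun_apply bounded_linear_Re bounded_linear_Im)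
  have L_cont: "continuous_on S (\<lambda>x. L (f x) (g x))"
    if "continuous_on S f" "continuous_on S g" for S :: "'b::topological_space set" and f g
    unfolding L_def using that by (intro continuous_intros)
  define G where "G z t = Re z *\<^sub>R a (t *\<^sub>R z) + Im z *\<^sub>R b (t *\<^sub>R z)" for z and t :: real
  \<comment> \<open>\<open>cx\<close> and \<open>cy\<close> are the partial derivatives of the
    radial integrand \<open>G z t\<close> with respect to \<open>Re z\<close> and
    \<open>Im z\<close>.\<close>
  define cx where "cx z t = a (t *\<^sub>R z) + t *\<^sub>R (Re z *\<^sub>R dx a (t *\<^sub>R z) + Im z *\<^sub>R dx b (t *\<^sub>R z))" for z and t :: real
  define cy where "cy z t = b (t *\<^sub>R z) + t *\<^sub>R (Re z *\<^sub>R dy a (t *\<^sub>R z) + Im z *\<^sub>R dy b (t *\<^sub>R z))" for z and t :: real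
  have diff: "a differentiable at z" "b differentiable at z" for z
    using a b smooth_iff by metis+
  have cont: "continuous_on UNIV a" "continuous_on UNIV b" "continuous_on UNIV (dx a)"
    "continuous_on UNIV (dx b)" "continuous_on UNIV (dy a)" "continuous_on UNIV (dy b)"
    using a b smooth_iff smooth_continuous by metis+
  have G_deriv: "((\<lambda>z. G z t) has_derivative blinfun_apply (L (cx z t) (cy z t))) (at z within UNIV)" for z t
  proof -
    have s: "((\<lambda>z. t *\<^sub>R z) has_derivative (\<lambda>h. t *\<^sub>R h)) (at z)"
      by (auto intro!: derivative_eq_intros)
    note da = has_derivative_compose[OF s has_derivative_dx_dy[OF diff(1)]]
    note db = has_derivative_compose[OF s has_derivative_dx_dy[OF diff(2)]]
    show ?thesis
      unfolding G_def
      by (rule derivative_eq_intros da db refl | simp)+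
        (simp add: L cx_def cy_def fun_eq_iff algebra_simps)
  qed
  have "((\<lambda>z. integral (cbox 0 1) (G z)) has_derivative
      integral (cbox 0 1) (\<lambda>t. L (cx z t) (cy z t))) (at z within UNIV)" for z
  proof (rule leibniz_rule[OF G_deriv])
    show "G z integrable_on cbox 0 1" for z
      unfolding G_def
      by (intro integrable_continuous continuous_intros continuous_on_compose2[OF cont(1)]
          continuous_on_compose2[OF cont(2)]) auto
    show "continuous_on (UNIV \<times> cbox 0 1) (\<lambda>(z, t). L (cx z t) (cy z t))"
      unfolding split_beta cx_def cy_def
      by (intro L_cont continuous_intros cont[THEN continuous_on_compose2]) auto
  qed auto
  moreover have "blinfun_apply (integral (cbox 0 1) (\<lambda>t. L (cx z t) (cy z t))) h =
      Re h *\<^sub>R a z + Im h *\<^sub>R b z" for z h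
  proof -
    have int: "(\<lambda>t. L (cx z t) (cy z t)) integrable_on cbox 0 1"
      unfolding cx_def cy_def
      by (intro integrable_continuous L_cont continuous_intros cont[THEN continuous_on_compose2]) auto
    \<comment> \<open>By closedness \<open>dx b\<close> may be exchanged with \<open>dy a\<close>,
      which turns \<open>cx z t\<close> into the t-derivative of
      \<open>t *\<^sub>R a (t *\<^sub>R z)\<close> and \<open>cy z t\<close> into that of
      \<open>t *\<^sub>R b (t *\<^sub>R z)\<close>. Only the endpoint t = 1 contributes.\<close>
    have "((\<lambda>t. Re h *\<^sub>R cx z t + Im h *\<^sub>R cy z t) has_integral
       (Re h *\<^sub>R (1 *\<^sub>R a (1 *\<^sub>R z)) + Im h *\<^sub>R (1 *\<^sub>R b (1 *\<^sub>R z)))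
        - (Re h *\<^sub>R (0 *\<^sub>R a (0 *\<^sub>R z)) + Im h *\<^sub>R (0 *\<^sub>R b (0 *\<^sub>R z)))) {0..1}"
    proof (rule fundamental_theorem_of_calculus)
      fix t :: real
      have s: "((\<lambda>t. t *\<^sub>R z) has_derivative (\<lambda>h. h *\<^sub>R z)) (at t within {0..1})"
        by (auto intro!: derivative_eq_intros)
      note da = has_derivative_compose[OF s has_derivative_dx_dy[OF diff(1)]]
      note db = has_derivative_compose[OF s has_derivative_dx_dy[OF diff(2)]]
      show "((\<lambda>t. Re h *\<^sub>R (t *\<^sub>R a (t *\<^sub>R z)) + Im h *\<^sub>R (t *\<^sub>R b (t *\<^sub>R z))) has_vector_derivative
          Re h *\<^sub>R cx z t + Im h *\<^sub>R cy z t) (at t within {0..1})"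
        unfolding has_vector_derivative_def
        by (rule derivative_eq_intros da db refl | simp)+
          (simp add: cx_def cy_def closed fun_eq_iff algebra_simps)
    qed simp
    then show ?thesis
      using blinfun_apply_integral[OF int] by (simp add: L integral_unique)
  qed
  then have "blinfun_apply (integral (cbox 0 1) (\<lambda>t. L (cx z t) (cy z t))) =
      (\<lambda>h. Re h *\<^sub>R a z + Im h *\<^sub>R b z)" for z
    by (rule ext)
  ultimately have "((\<lambda>z. integral (cbox 0 1) (G z)) has_derivative
      (\<lambda>h. Re h *\<^sub>R a z + Im h *\<^sub>R b z)) (at z)" for z
    by metis
  then show ?thesis by (rule that)
qed

text \<open>The form with coefficients p and q along dz and dzbar has real components
  \<open>p + q\<close> and \<open>\<i> * (p - q)\<close>; for these, closedness is the hypothesis on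
  \<open>dzbar p\<close> and \<open>dz q\<close>.\<close>

lemma smooth_wirtinger_system_solvable:
  assumes p: "smooth p" and q: "smooth q" and closed: "\<And>z. dzbar p z = dz q z"
  obtains F where "\<And>z. has_wirtinger F (p z) (q z) z"
proof (rule smooth_closed_form_exact)
  show "smooth (\<lambda>z. p z + q z)" "smooth (\<lambda>z. \<i> * (p z - q z))"
    by (intro smooth_intros p q)+
  note pq = smooth_has_wirtinger[OF p] smooth_has_wirtinger[OF q]
  show "dy (\<lambda>z. p z + q z) z = dx (\<lambda>z. \<i> * (p z - q z)) z" for z
    unfolding has_wirtinger_D(3)[OF has_wirtinger_add[OF pq]]
      has_wirtinger_D(2)[OF has_wirtinger_cmult[OF has_wirtinger_diff[OF pq]]]
    by (simp add: closed algebra_simps)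
  fix F assume F: "(F has_derivative (\<lambda>h. Re h *\<^sub>R (p z + q z) + Im h *\<^sub>R (\<i> * (p z - q z)))) (at z)" for z
  have "(\<lambda>h. Re h *\<^sub>R (p z + q z) + Im h *\<^sub>R (\<i> * (p z - q z))) = (\<lambda>h. p z * h + q z * cnj h)" for z
    by (auto simp: complex_eq_iff algebra_simps)
  with F have "has_wirtinger F (p z) (q z) z" for z
    unfolding has_wirtinger_def by metis
  then show thesis by (rule that)
qed

section \<open>The Lax equation in components\<close>

lemma mat2_nth [simp]:
  "mat2 a b c d $ 1 $ 1 = a" "mat2 a b c d $ 1 $ 2 = b"
  "mat2 a b c d $ 2 $ 1 = c" "mat2 a b c d $ 2 $ 2 = d"
  by (simp_all add: mat2_def)

lemma mat2_eq_iff: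
  "mat2 a b c d = mat2 a' b' c' d' \<longleftrightarrow> a = a' \<and> b = b' \<and> c = c' \<and> d = d'"
  by (auto simp: vec_eq_iff forall_2)

lemma mat2_add: "mat2 a b c d + mat2 a' b' c' d' = mat2 (a + a') (b + b') (c + c') (d + d')"
  by (simp add: vec_eq_iff forall_2)

lemma cscale_mat2: "cscale x (mat2 a b c d) = mat2 (x * a) (x * b) (x * c) (x * d)"
  by (simp add: cscale_def vec_eq_iff forall_2)

lemma sum_mat2:
  "(\<Sum>n\<in>S. mat2 (a n) (b n) (c n) (d n)) =
     mat2 (\<Sum>n\<in>S. a n) (\<Sum>n\<in>S. b n) (\<Sum>n\<in>S. c n) (\<Sum>n\<in>S. d n)"
  by (simp add: vec_eq_iff forall_2)

lemma commutator_mat2: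
  "commutator (mat2 a b c d) (mat2 a' b' c' d') =
     mat2 (b * c' - b' * c) (a * b' + b * d' - a' * b - b' * d)
       (c * a' + d * c' - c' * a - d' * c) (c * b' - c' * b)"
  by (simp add: commutator_def matrix_matrix_mult_def vec_eq_iff forall_2 sum_2 algebra_simps)

lemma alpha_eq_mat2:
  "alpha \<gamma> \<omega> l z h =
     mat2 (1/2 * (omega_z \<omega> z * h - omega_zbar \<omega> z * cnj h))
       (\<i>/4 * (inverse l * e_pow (\<omega> z) * h + cnj \<gamma> * e_pow (- \<omega> z) * cnj h))
       (\<i>/4 * (\<gamma> * e_pow (- \<omega> z) * h + l * e_pow (\<omega> z) * cnj h))
       (- (1/2 * (omega_z \<omega> z * h - omega_zbar \<omega> z * cnj h)))"
  by (simp add: alpha_def cscale_mat2 mat2_add mat2_eq_iff algebra_simps)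

lemma has_derivative_mat2:
  "((\<lambda>z. mat2 (a z) (b z) (c z) (d z)) has_derivative (\<lambda>h. mat2 (a' h) (b' h) (c' h) (d' h))) F \<longleftrightarrow>
     (a has_derivative a') F \<and> (b has_derivative b') F \<and> (c has_derivative c') F \<and> (d has_derivative d') F"
  (is "?L \<longleftrightarrow> ?R")
proof
  assume ?L
  then have "((\<lambda>z. mat2 (a z) (b z) (c z) (d z) $ i $ j) has_derivative
      (\<lambda>h. mat2 (a' h) (b' h) (c' h) (d' h) $ i $ j)) F" for i j
    by (intro bounded_linear.has_derivative[OF bounded_linear_vec_nth])
  from this[of 1 1] this[of 1 2] this[of 2 1] this[of 2 2] show ?R
    by simp
next
  assume R: ?R
  have lin: "linear (\<lambda>x. mat2 x 0 0 0)" "linear (\<lambda>x. mat2 0 x 0 0)"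
    "linear (\<lambda>x. mat2 0 0 x 0)" "linear (\<lambda>x. mat2 0 0 0 x)"
    by (rule linearI; simp add: vec_eq_iff forall_2)+
  note bl = lin[THEN linear_conv_bounded_linear[THEN iffD1]]
  have "((\<lambda>z. mat2 (a z) 0 0 0 + mat2 0 (b z) 0 0 + mat2 0 0 (c z) 0 + mat2 0 0 0 (d z)) has_derivative
      (\<lambda>h. mat2 (a' h) 0 0 0 + mat2 0 (b' h) 0 0 + mat2 0 0 (c' h) 0 + mat2 0 0 0 (d' h))) F"
    using R by (intro has_derivative_add bl[THEN bounded_linear.has_derivative]) auto
  then show ?L
    by (simp add: mat2_add)
qed

lemma e_pow_exp: "e_pow x = exp (complex_of_real x)"
  by (simp add: e_pow_def exp_of_real)

lemma e_pow_nonzero [simp]: "e_pow x \<noteq> 0"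
  by (simp add: e_pow_exp)

lemma e_pow_simps:
  "e_pow (- x) = inverse (e_pow x)" "e_pow (2 * x) = e_pow x ^ 2" "e_pow (- 2 * x) = inverse (e_pow x ^ 2)"
  "e_pow (- (2 * x)) = inverse (e_pow x ^ 2)"
  by (simp_all add: e_pow_exp exp_minus exp_double)

lemma has_wirtinger_e_pow:
  assumes "smooth \<omega>"
  shows "has_wirtinger (\<lambda>z. e_pow (c * \<omega> z)) (c * omega_z \<omega> z * e_pow (c * \<omega> z))
    (c * omega_zbar \<omega> z * e_pow (c * \<omega> z)) z"
  using has_wirtinger_exp[OF has_wirtinger_cmult[OF smooth_has_wirtinger[OF smooth_of_real[OF assms]], of c]]
  by (simp add: e_pow_exp omega_z_def omega_zbar_def mult_ac)

lemma smooth_e_pow: "smooth \<omega> \<Longrightarrow> smooth (\<lambda>z. e_pow (c * \<omega> z))"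
  unfolding e_pow_exp of_real_mult by (intro smooth_exp smooth_mult smooth_const smooth_of_real)

text \<open>The factor \<open>e_pow (\<omega> z)\<close> is smooth and invertible, so it can be
  stripped off in both directions. The summands \<open>omega_z \<omega> z * b z\<close> and the like
  stay unsimplified here and in the commutator formulas below, so that pb, qb, pc, qc can be matched
  there literally.\<close>

lemma has_derivative_phi_iff:
  assumes \<omega>: "smooth \<omega>"
  shows "((\<lambda>z. mat2 (a z) (e_pow (\<omega> z) * b z) (e_pow (\<omega> z) * c z) (- a z)) has_derivative
      (\<lambda>h. mat2 (pa * h + qa * cnj h)
         (e_pow (\<omega> z) * ((pb + omega_z \<omega> z * b z) * h + (qb + omega_zbar \<omega> z * b z) * cnj h))
         (e_pow (\<omega> z) * ((pc + omega_z \<omega> z * c z) * h + (qc + omega_zbar \<omega> z * c z) * cnj h))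
         (- (pa * h + qa * cnj h)))) (at z) \<longleftrightarrow>
    has_wirtinger a pa qa z \<and> has_wirtinger b pb qb z \<and> has_wirtinger c pc qc z"
proof -
  have scaled: "((\<lambda>z. e_pow (\<omega> z) * b z) has_derivative
      (\<lambda>h. e_pow (\<omega> z) * ((pb + omega_z \<omega> z * b z) * h + (qb + omega_zbar \<omega> z * b z) * cnj h))) (at z)
      \<longleftrightarrow> has_wirtinger b pb qb z" for b pb qb
  proof
    assume "((\<lambda>z. e_pow (\<omega> z) * b z) has_derivative
      (\<lambda>h. e_pow (\<omega> z) * ((pb + omega_z \<omega> z * b z) * h + (qb + omega_zbar \<omega> z * b z) * cnj h))) (at z)"
    then have "has_wirtinger (\<lambda>z. e_pow (\<omega> z) * b z) (e_pow (\<omega> z) * (pb + omega_z \<omega> z * b z))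
        (e_pow (\<omega> z) * (qb + omega_zbar \<omega> z * b z)) z"
      by (simp add: has_wirtinger_def algebra_simps)
    from has_wirtinger_mult[OF has_wirtinger_e_pow[OF \<omega>, of "-1"] this]
    show "has_wirtinger b pb qb z"
      by (simp add: e_pow_simps field_simps)
  next
    assume "has_wirtinger b pb qb z"
    from has_wirtinger_mult[OF has_wirtinger_e_pow[OF \<omega>, of 1] this]
    show "((\<lambda>z. e_pow (\<omega> z) * b z) has_derivative
      (\<lambda>h. e_pow (\<omega> z) * ((pb + omega_z \<omega> z * b z) * h + (qb + omega_zbar \<omega> z * b z) * cnj h))) (at z)"
      by (simp add: has_wirtinger_def algebra_simps)
  qed
  have "((\<lambda>z. - a z) has_derivative (\<lambda>h. - (pa * h + qa * cnj h))) (at z)" if "has_wirtinger a pa qa z"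
    using that unfolding has_wirtinger_def by (rule has_derivative_minus)
  then show ?thesis
    unfolding has_derivative_mat2 scaled by (auto simp: has_wirtinger_def)
qed

lemma commutator_phi_alpha:
  assumes "l \<noteq> 0"
  shows "commutator (mat2 a (e_pow (\<omega> z) * b) (e_pow (\<omega> z) * c) (- a)) (alpha \<gamma> \<omega> l z h) =
    mat2 (\<i>/4 * (\<gamma> * b - e_pow (2 * \<omega> z) * (inverse l * c)) * h +
          \<i>/4 * (e_pow (2 * \<omega> z) * (l * b) - cnj \<gamma> * c) * cnj h)
      (e_pow (\<omega> z) *
        ((- 2 * omega_z \<omega> z * b + \<i>/2 * (inverse l * a) + omega_z \<omega> z * b) * h +
         (\<i>/2 * cnj \<gamma> * e_pow (- 2 * \<omega> z) * a + omega_zbar \<omega> z * b) * cnj h))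
      (e_pow (\<omega> z) *
        ((- \<i>/2 * \<gamma> * e_pow (- 2 * \<omega> z) * a + omega_z \<omega> z * c) * h +
         (- 2 * omega_zbar \<omega> z * c - \<i>/2 * (l * a) + omega_zbar \<omega> z * c) * cnj h))
      (- (\<i>/4 * (\<gamma> * b - e_pow (2 * \<omega> z) * (inverse l * c)) * h +
          \<i>/4 * (e_pow (2 * \<omega> z) * (l * b) - cnj \<gamma> * c) * cnj h))"
  unfolding alpha_eq_mat2 commutator_mat2 mat2_eq_iff e_pow_simps
  using assms by (simp add: field_simps power2_eq_square)

text \<open>The Lax equation at the n-th power of the spectral parameter, entry by entry, with the
  factor \<open>e_pow (\<omega> z)\<close> removed. The index n + 1 comes from the inverse power in
  \<open>alpha\<close>, which accompanies dz, and n - 1 from the first power, which accompanies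
  dzbar.\<close>

definition lax_recursion ::
    "complex \<Rightarrow> (complex \<Rightarrow> real) \<Rightarrow> (int \<Rightarrow> complex \<Rightarrow> complex) \<Rightarrow>
     (int \<Rightarrow> complex \<Rightarrow> complex) \<Rightarrow> (int \<Rightarrow> complex \<Rightarrow> complex) \<Rightarrow> int \<Rightarrow> complex \<Rightarrow> bool" where
  "lax_recursion \<gamma> \<omega> u \<tau> \<sigma> n z \<longleftrightarrow>
     has_wirtinger (u n) (\<i>/4 * (\<gamma> * \<tau> n z - e_pow (2 * \<omega> z) * \<sigma> (n + 1) z))
       (\<i>/4 * (e_pow (2 * \<omega> z) * \<tau> (n - 1) z - cnj \<gamma> * \<sigma> n z)) z \<and>
     has_wirtinger (\<tau> n) (- 2 * omega_z \<omega> z * \<tau> n z + \<i>/2 * u (n + 1) z)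
       (\<i>/2 * cnj \<gamma> * e_pow (- 2 * \<omega> z) * u n z) z \<and>
     has_wirtinger (\<sigma> n) (- \<i>/2 * \<gamma> * e_pow (- 2 * \<omega> z) * u n z)
       (- 2 * omega_zbar \<omega> z * \<sigma> n z - \<i>/2 * u (n - 1) z) z"

lemma sum_commutator_phi_alpha_coeff:
  "(\<Sum>j\<in>{-1, 0, 1}. commutator (Phi_coeff \<omega> u \<tau> \<sigma> (k - j) z) (alpha_coeff \<gamma> \<omega> j z h)) =
    mat2 (\<i>/4 * (\<gamma> * \<tau> k z - e_pow (2 * \<omega> z) * \<sigma> (k + 1) z) * h +
          \<i>/4 * (e_pow (2 * \<omega> z) * \<tau> (k - 1) z - cnj \<gamma> * \<sigma> k z) * cnj h)
      (e_pow (\<omega> z) *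
        ((- 2 * omega_z \<omega> z * \<tau> k z + \<i>/2 * u (k + 1) z + omega_z \<omega> z * \<tau> k z) * h +
         (\<i>/2 * cnj \<gamma> * e_pow (- 2 * \<omega> z) * u k z + omega_zbar \<omega> z * \<tau> k z) * cnj h))
      (e_pow (\<omega> z) *
        ((- \<i>/2 * \<gamma> * e_pow (- 2 * \<omega> z) * u k z + omega_z \<omega> z * \<sigma> k z) * h +
         (- 2 * omega_zbar \<omega> z * \<sigma> k z - \<i>/2 * u (k - 1) z + omega_zbar \<omega> z * \<sigma> k z) * cnj h))
      (- (\<i>/4 * (\<gamma> * \<tau> k z - e_pow (2 * \<omega> z) * \<sigma> (k + 1) z) * h +
          \<i>/4 * (e_pow (2 * \<omega> z) * \<tau> (k - 1) z - cnj \<gamma> * \<sigma> k z) * cnj h))"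
  unfolding e_pow_simps
  by (simp add: alpha_coeff_def Phi_coeff_def cscale_mat2 mat2_add commutator_mat2 mat2_eq_iff
      e_pow_simps(1) field_simps power2_eq_square)

lemma formal_solution_iff:
  assumes "smooth \<omega>"
  shows "formal_solution \<gamma> \<omega> u \<tau> \<sigma> \<longleftrightarrow>
    formal_shape u \<tau> \<sigma> \<and> (\<forall>n z. lax_recursion \<gamma> \<omega> u \<tau> \<sigma> n z)"
  unfolding formal_solution_def sum_commutator_phi_alpha_coeff lax_recursion_def
  unfolding Phi_coeff_def has_derivative_phi_iff[OF assms] ..

section \<open>Separation of the powers of the spectral parameter\<close>

text \<open>
  The coefficients are not known to be differentiable individually: compare the values at l and
  2 l to eliminate the leading one.
\<close>

lemma has_wirtinger_polynomial_coeff: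
  assumes "\<And>l. l \<noteq> 0 \<Longrightarrow>
      has_wirtinger (\<lambda>z. \<Sum>m\<le>M. l ^ m * f m z) (\<Sum>m\<le>M. l ^ m * p m) (\<Sum>m\<le>M. l ^ m * q m) z"
    and "m \<le> M"
  shows "has_wirtinger (f m) (p m) (q m) z"
  using assms
proof (induction M arbitrary: f p q m)
  case 0
  from "0.prems"(1)[of 1] "0.prems"(2) show ?case by simp
next
  case (Suc M)
  \<comment> \<open>The factor that the elimination leaves at index m; powers of 2 being distinct,
    it vanishes only at \<open>Suc M\<close>.\<close>
  define d where "d m = (2 ^ m - 2 ^ Suc M :: complex)" for m
  have d: "d m \<noteq> 0" if "m \<le> M" for m
  proof
    assume "d m = 0"
    then have "of_nat (2 ^ m) = (of_nat (2 ^ Suc M) :: complex)"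
      by (simp add: d_def)
    then have "m = Suc M"
      by (simp only: of_nat_eq_iff power_inject_exp one_less_numeral_iff semiring_norm)
    with that show False by simp
  qed
  have elim: "(\<Sum>m\<le>Suc M. (2 * l) ^ m * x m) - 2 ^ Suc M * (\<Sum>m\<le>Suc M. l ^ m * x m) =
      (\<Sum>m\<le>M. l ^ m * (d m * x m))" for l :: complex and x
    by (simp add: d_def power_mult_distrib sum_distrib_left algebra_simps flip: sum_subtractf)
  have low: "has_wirtinger (f m) (p m) (q m) z" if "m \<le> M" for m
  proof -
    have "has_wirtinger (\<lambda>z. d m * f m z) (d m * p m) (d m * q m) z"
    proof (rule Suc.IH[OF _ that])
      fix l :: complex assume "l \<noteq> 0"
      then show "has_wirtinger (\<lambda>z. \<Sum>m\<le>M. l ^ m * (d m * f m z)) (\<Sum>m\<le>M. l ^ m * (d m * p m))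
          (\<Sum>m\<le>M. l ^ m * (d m * q m)) z"
        unfolding elim[symmetric]
        by (intro has_wirtinger_diff has_wirtinger_cmult Suc.prems) auto
    qed
    from has_wirtinger_cmult[OF this, of "inverse (d m)"] show ?thesis
      using d[OF that] by (simp add: field_simps)
  qed
  \<comment> \<open>The top coefficient is recovered at l = 1 by subtracting the lower ones, which
    are differentiable by now.\<close>
  have sum: "has_wirtinger (\<lambda>z. \<Sum>m\<le>N. f m z) (\<Sum>m\<le>N. p m) (\<Sum>m\<le>N. q m) z" if "N \<le> M" for N
    using that by (induction N) (simp_all add: low has_wirtinger_add)
  have "has_wirtinger (f (Suc M)) (p (Suc M)) (q (Suc M)) z"
    using has_wirtinger_diff[OF Suc.prems(1)[of 1] sum[of M]] by simp
  with low Suc.prems(2) show ?case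
    by (cases "m = Suc M") auto
qed

definition laurent_sum :: "nat \<Rightarrow> (int \<Rightarrow> complex) \<Rightarrow> complex \<Rightarrow> complex" where
  "laurent_sum g f l = inverse l * f (-1) + (\<Sum>n = 0..g. l ^ n * f (int n))"

text \<open>With n = m - 2 the three sums carry the indices n + 1, n and n - 1 over one common range
  of m, so that coefficients of equal powers can be compared; the terms added to fill the range
  vanish by hypothesis.\<close>

lemma laurent_sum_shift:
  assumes "l \<noteq> 0" "\<forall>n. n < -1 \<or> n > int g \<longrightarrow> f n = 0"
  shows "(\<Sum>m\<le>g + 3. l ^ m * f (int m - 1)) = l * laurent_sum g f l"
    "(\<Sum>m\<le>g + 3. l ^ m * f (int m - 2)) = l ^ 2 * laurent_sum g f l"
    "(\<Sum>m\<le>g + 3. l ^ m * f (int m - 3)) = l ^ 3 * laurent_sum g f l"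
proof -
  have base: "(\<Sum>m\<le>Suc g. l ^ m * f (int m - 1)) = l * laurent_sum g f l"
    unfolding sum.atMost_Suc_shift using assms(1)
    by (simp add: laurent_sum_def distrib_left sum_distrib_left mult_ac atLeast0AtMost)
  show 1: "(\<Sum>m\<le>g + 3. l ^ m * f (int m - 1)) = l * laurent_sum g f l"
    using base by (simp add: numeral_3_eq_3 assms(2))
  have 2: "(\<Sum>m\<le>Suc (Suc g). l ^ m * f (int m - 2)) = l ^ 2 * laurent_sum g f l"
    unfolding sum.atMost_Suc_shift[of _ "Suc g"] using base
    by (simp add: assms(2) power2_eq_square mult.assoc flip: sum_distrib_left)
  show "(\<Sum>m\<le>g + 3. l ^ m * f (int m - 2)) = l ^ 2 * laurent_sum g f l"
    using 2 by (simp add: numeral_3_eq_3 assms(2))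
  show "(\<Sum>m\<le>g + 3. l ^ m * f (int m - 3)) = l ^ 3 * laurent_sum g f l"
    unfolding numeral_3_eq_3 add_Suc_right sum.atMost_Suc_shift[of _ "Suc (Suc _)"] using 2
    by (simp add: assms(2) power2_eq_square mult.assoc flip: sum_distrib_left)
qed

lemma Phi_eq_mat2:
  assumes "formal_shape u \<tau> \<sigma>"
  shows "Phi g \<omega> u \<tau> \<sigma> l z =
    mat2 (laurent_sum g (\<lambda>n. u n z) l) (e_pow (\<omega> z) * laurent_sum g (\<lambda>n. \<tau> n z) l)
      (e_pow (\<omega> z) * laurent_sum g (\<lambda>n. \<sigma> n z) l) (- laurent_sum g (\<lambda>n. u n z) l)"
proof -
  have "u (-1) z = 0" "\<sigma> (-1) z = 0" "\<tau> (-1) z = \<i> / 4"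
    using assms by (simp_all add: formal_shape_def)
  then show ?thesis
    by (simp add: Phi_def Phi_coeff_def cscale_mat2 sum_mat2 mat2_add mat2_eq_iff laurent_sum_def
        sum_distrib_left sum_negf algebra_simps)
qed

lemma lax_solution_imp_formal_solution:
  assumes \<omega>: "smooth \<omega>" and shape: "polynomial_shape g u \<tau> \<sigma>"
    and lax: "lax_solution \<gamma> \<omega> (Phi g \<omega> u \<tau> \<sigma>)"
  shows "formal_solution \<gamma> \<omega> u \<tau> \<sigma>"
  unfolding formal_solution_iff[OF \<omega>]
proof (intro conjI allI)
  show fs: "formal_shape u \<tau> \<sigma>"
    using shape by (simp add: polynomial_shape_def)
  fix n z
  have zero: "u n = (\<lambda>w. 0)" "\<tau> n = (\<lambda>w. 0)" "\<sigma> n = (\<lambda>w. 0)" if "n < -1 \<or> n > int g" for n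
    using that shape unfolding polynomial_shape_def formal_shape_def by auto
  let ?L = "\<lambda>f l z. laurent_sum g (\<lambda>n. f n z) l"
  have deriv: "has_wirtinger (?L u l) (\<i>/4 * (\<gamma> * ?L \<tau> l z - e_pow (2 * \<omega> z) * (inverse l * ?L \<sigma> l z)))
        (\<i>/4 * (e_pow (2 * \<omega> z) * (l * ?L \<tau> l z) - cnj \<gamma> * ?L \<sigma> l z)) z \<and>
      has_wirtinger (?L \<tau> l) (- 2 * omega_z \<omega> z * ?L \<tau> l z + \<i>/2 * (inverse l * ?L u l z))
        (\<i>/2 * cnj \<gamma> * e_pow (- 2 * \<omega> z) * ?L u l z) z \<and>
      has_wirtinger (?L \<sigma> l) (- \<i>/2 * \<gamma> * e_pow (- 2 * \<omega> z) * ?L u l z)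
        (- 2 * omega_zbar \<omega> z * ?L \<sigma> l z - \<i>/2 * (l * ?L u l z)) z" if "l \<noteq> 0" for l
    using lax[unfolded lax_solution_def, rule_format, OF that, of z]
    unfolding Phi_eq_mat2[OF fs] commutator_phi_alpha[OF that]
      has_derivative_phi_iff[OF \<omega>, of "?L u l" "?L \<tau> l" "?L \<sigma> l"] .
  have zero': "\<forall>n. n < -1 \<or> n > int g \<longrightarrow> u n w = 0" "\<forall>n. n < -1 \<or> n > int g \<longrightarrow> \<tau> n w = 0"
    "\<forall>n. n < -1 \<or> n > int g \<longrightarrow> \<sigma> n w = 0" for w
    by (simp_all add: zero)
  note shift = laurent_sum_shift[OF _ zero'(1)] laurent_sum_shift[OF _ zero'(2)]
    laurent_sum_shift[OF _ zero'(3)]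
  define pu where "pu n = \<i>/4 * (\<gamma> * \<tau> n z - e_pow (2 * \<omega> z) * \<sigma> (n + 1) z)" for n
  define qu where "qu n = \<i>/4 * (e_pow (2 * \<omega> z) * \<tau> (n - 1) z - cnj \<gamma> * \<sigma> n z)" for n
  define pt where "pt n = - 2 * omega_z \<omega> z * \<tau> n z + \<i>/2 * u (n + 1) z" for n
  define qt where "qt n = \<i>/2 * cnj \<gamma> * e_pow (- 2 * \<omega> z) * u n z" for n
  define ps where "ps n = - \<i>/2 * \<gamma> * e_pow (- 2 * \<omega> z) * u n z" for n
  define qs where "qs n = - 2 * omega_zbar \<omega> z * \<sigma> n z - \<i>/2 * u (n - 1) z" for n
  have lin: "(\<Sum>m\<le>M. l ^ m * (c * x m)) = c * (\<Sum>m\<le>M. l ^ m * x m)"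
    "(\<Sum>m\<le>M. l ^ m * (x m + y m)) = (\<Sum>m\<le>M. l ^ m * x m) + (\<Sum>m\<le>M. l ^ m * y m)"
    "(\<Sum>m\<le>M. l ^ m * (x m - y m)) = (\<Sum>m\<le>M. l ^ m * x m) - (\<Sum>m\<le>M. l ^ m * y m)"
    for l c :: complex and x y :: "nat \<Rightarrow> complex" and M
    by (simp_all add: sum_distrib_left mult.left_commute distrib_left right_diff_distrib
        sum.distrib sum_subtractf)
  have idx: "int m - 2 + 1 = int m - 1" "int m - 2 - 1 = int m - 3" for m
    by simp_all
  \<comment> \<open>The equation is multiplied by \<open>l ^ 2\<close>: its exponents reach from -2,
    where \<open>inverse l\<close> meets the leading term, to g + 1, so m = n + 2 runs from 0 to g +
    3.\<close>
  have "has_wirtinger (u (int m - 2)) (pu (int m - 2)) (qu (int m - 2)) z \<and>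
      has_wirtinger (\<tau> (int m - 2)) (pt (int m - 2)) (qt (int m - 2)) z \<and>
      has_wirtinger (\<sigma> (int m - 2)) (ps (int m - 2)) (qs (int m - 2)) z" if m: "m \<le> g + 3" for m
  proof (intro conjI; rule has_wirtinger_polynomial_coeff[OF _ m])
    fix l :: complex assume l: "l \<noteq> 0"
    note d = deriv[OF l, THEN conjunct1, THEN has_wirtinger_cmult[where c="l ^ 2"]]
      deriv[OF l, THEN conjunct2, THEN conjunct1, THEN has_wirtinger_cmult[where c="l ^ 2"]]
      deriv[OF l, THEN conjunct2, THEN conjunct2, THEN has_wirtinger_cmult[where c="l ^ 2"]]
    show "has_wirtinger (\<lambda>z. \<Sum>m\<le>g + 3. l ^ m * u (int m - 2) z)
        (\<Sum>m\<le>g + 3. l ^ m * pu (int m - 2)) (\<Sum>m\<le>g + 3. l ^ m * qu (int m - 2)) z"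
      unfolding pu_def qu_def idx lin shift[OF l]
      by (rule has_wirtinger_eq_rhs[OF d(1)])
        (use l in \<open>simp_all add: field_simps power2_eq_square power3_eq_cube\<close>)
    show "has_wirtinger (\<lambda>z. \<Sum>m\<le>g + 3. l ^ m * \<tau> (int m - 2) z)
        (\<Sum>m\<le>g + 3. l ^ m * pt (int m - 2)) (\<Sum>m\<le>g + 3. l ^ m * qt (int m - 2)) z"
      unfolding pt_def qt_def idx lin shift[OF l]
      by (rule has_wirtinger_eq_rhs[OF d(2)])
        (use l in \<open>simp_all add: field_simps power2_eq_square power3_eq_cube\<close>)
    show "has_wirtinger (\<lambda>z. \<Sum>m\<le>g + 3. l ^ m * \<sigma> (int m - 2) z)
        (\<Sum>m\<le>g + 3. l ^ m * ps (int m - 2)) (\<Sum>m\<le>g + 3. l ^ m * qs (int m - 2)) z"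
      unfolding ps_def qs_def idx lin shift[OF l]
      by (rule has_wirtinger_eq_rhs[OF d(3)])
        (use l in \<open>simp_all add: field_simps power2_eq_square power3_eq_cube\<close>)
  qed
  from this[of "nat (n + 2)"]
  have "lax_recursion \<gamma> \<omega> u \<tau> \<sigma> n z" if "-2 \<le> n" "n \<le> int g + 1"
    using that by (simp add: lax_recursion_def pu_def qu_def pt_def qt_def ps_def qs_def nat_le_iff)
  \<comment> \<open>Here n - 1, n and n + 1 all lie outside the range from -1 to g, and every
    equation reads 0 = 0.\<close>
  moreover have "lax_recursion \<gamma> \<omega> u \<tau> \<sigma> n z" if "n < -2 \<or> n > int g + 1"
  proof -
    have "n < -1 \<or> n > int g" "n + 1 < -1 \<or> n + 1 > int g" "n - 1 < -1 \<or> n - 1 > int g"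
      using that by auto
    note this[THEN zero(1)] this[THEN zero(2)] this[THEN zero(3)]
    then show ?thesis
      by (simp add: lax_recursion_def has_wirtinger_const)
  qed
  ultimately show "lax_recursion \<gamma> \<omega> u \<tau> \<sigma> n z"
    by linarith
qed

section \<open>The recursion for the coefficients\<close>

lemma laplacian_of_real:
  assumes "smooth \<omega>"
  shows "laplacian (\<lambda>z. complex_of_real (\<omega> z)) z = of_real (laplacian \<omega> z)"
proof -
  have d: "\<omega> differentiable at z" "dx \<omega> differentiable at z" "dy \<omega> differentiable at z" for z
    using assms smooth_iff by metis+
  have "dx (\<lambda>z. complex_of_real (\<omega> z)) = (\<lambda>z. of_real (dx \<omega> z))"
    "dy (\<lambda>z. complex_of_real (\<omega> z)) = (\<lambda>z. of_real (dy \<omega> z))"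
    using dx_of_real d(1) by auto
  then show ?thesis
    by (simp add: laplacian_def dx_of_real d)
qed

lemma of_real_cosh_double: "complex_of_real (cosh (2 * x)) = (e_pow (2 * x) + e_pow (- 2 * x)) / 2"
  by (simp add: cosh_def e_pow_def)

lemma of_real_sinh_cosh: "complex_of_real (sinh x * cosh x) = (e_pow (2 * x) - e_pow (- 2 * x)) / 4"
proof -
  have "sinh x * cosh x = (exp (2 * x) - exp (- 2 * x)) / 4"
    using sinh_double[of x] by (simp add: sinh_field_def[of "2 * x"])
  then show ?thesis
    by (simp only: e_pow_def of_real_divide of_real_diff of_real_numeral)
qed

lemma smooth_omega_z:
  assumes "smooth \<omega>"
  shows "smooth (omega_z \<omega>)" "smooth (omega_zbar \<omega>)"
  unfolding omega_z_def omega_zbar_def using assms smooth_dz smooth_of_real by blast+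

lemma cnj_omega_z:
  assumes "smooth \<omega>"
  shows "cnj (omega_z \<omega> z) = omega_zbar \<omega> z"
proof -
  have "\<omega> differentiable at z"
    using assms smooth_iff by blast
  then show ?thesis
    by (simp add: omega_z_def omega_zbar_def dz_def dzbar_def dx_of_real)
qed

text \<open>The 16 is 4 from \<open>dzbar (dz f) z = laplacian f z / 4\<close> times 4 from writing
  \<open>sinh x * cosh x\<close> in exponentials.\<close>

lemma sinh_gordon_iff:
  assumes "smooth \<omega>"
  shows "sinh_gordon \<omega> \<longleftrightarrow> (\<forall>z. dzbar (omega_z \<omega>) z = (e_pow (- 2 * \<omega> z) - e_pow (2 * \<omega> z)) / 16)"
proof -
  have "laplacian \<omega> z + sinh (\<omega> z) * cosh (\<omega> z) = 0 \<longleftrightarrow>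
      dzbar (omega_z \<omega>) z = (e_pow (- 2 * \<omega> z) - e_pow (2 * \<omega> z)) / 16" for z
  proof -
    have "laplacian \<omega> z + sinh (\<omega> z) * cosh (\<omega> z) = 0 \<longleftrightarrow>
        complex_of_real (laplacian \<omega> z) + complex_of_real (sinh (\<omega> z) * cosh (\<omega> z)) = 0"
      by (simp only: flip: of_real_add of_real_eq_0_iff)
    then show ?thesis
      unfolding of_real_sinh_cosh omega_z_def dz_dzbar_laplacian(2)[OF smooth_of_real[OF assms]]
        laplacian_of_real[OF assms]
      by (auto simp: field_simps)
  qed
  then show ?thesis
    using assms by (simp add: sinh_gordon_def)
qed

lemma linearized_sinh_gordon_iff:
  "linearized_sinh_gordon \<omega> v \<longleftrightarrow>
     smooth v \<and> (\<forall>z. dzbar (dz v) z = - (1/8) * (e_pow (2 * \<omega> z) + e_pow (- 2 * \<omega> z)) * v z)"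
proof (cases "smooth v")
  case True
  have "laplacian v z + v z * ((e + f) / 2) = 0 \<longleftrightarrow> laplacian v z / 4 = - (1/8) * (e + f) * v z" for z e f
  proof -
    have "laplacian v z + v z * ((e + f) / 2) = 4 * (laplacian v z / 4 - (- (1/8) * (e + f) * v z))"
      by (simp add: field_simps)
    then show ?thesis
      by (simp only: mult_eq_0_iff right_minus_eq) simp
  qed
  then show ?thesis
    unfolding linearized_sinh_gordon_def of_real_cosh_double dz_dzbar_laplacian(2)[OF True] by simp
qed (simp add: linearized_sinh_gordon_def)

lemma tau_system_iff:
  "tau_system \<gamma> \<omega> v t \<longleftrightarrow>
     (\<forall>z. has_wirtinger t (- 2 * \<i> * cnj \<gamma> * (dz (dz v) z - 2 * omega_z \<omega> z * dz v z))
       (\<i>/2 * cnj \<gamma> * e_pow (- 2 * \<omega> z) * v z) z)"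
  unfolding tau_system_def has_wirtinger_iff by (auto simp: algebra_simps)

text \<open>Sinh-Gordon is kept out of this locale since it is derived here from the recursion; the
  iteration, which relies on it, is treated in \<open>sinh_gordon_solution\<close>.\<close>

locale unimodular_parameter =
  fixes \<omega> :: "complex \<Rightarrow> real" and \<gamma> :: complex
  assumes smooth_\<omega>: "smooth \<omega>" and norm_\<gamma>: "norm \<gamma> = 1"
begin

abbreviation "w \<equiv> omega_z \<omega>"
abbreviation "w' \<equiv> omega_zbar \<omega>"
abbreviation "E z \<equiv> e_pow (2 * \<omega> z)"
abbreviation "F z \<equiv> e_pow (- 2 * \<omega> z)"

lemma gamma_cnj: "\<gamma> * cnj \<gamma> = 1" "cnj \<gamma> * \<gamma> = 1"
  using norm_\<gamma> by (simp_all add: complex_norm_square[symmetric] mult.commute[of "cnj \<gamma>"])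

lemma E_F: "E z * F z = 1"
  by (simp add: e_pow_simps)

lemma has_wirtinger_E: "has_wirtinger E (2 * w z * E z) (2 * w' z * E z) z"
  using has_wirtinger_e_pow[OF smooth_\<omega>, of 2] by simp

lemma has_wirtinger_F: "has_wirtinger F (- 2 * w z * F z) (- 2 * w' z * F z) z"
  using has_wirtinger_e_pow[OF smooth_\<omega>, of "-2"] by simp

lemma smooth_E_F: "smooth E" "smooth F"
  by (rule smooth_e_pow[OF smooth_\<omega>])+

text \<open>Both derivatives of each coefficient are polynomial in smooth functions and in
  coefficients with neighbouring indices, so one order of regularity for all indices gives the next
  order. Hence the induction on k keeps n arbitrary.\<close>

lemma lax_recursion_C_k:
  assumes R: "\<And>n z. lax_recursion \<gamma> \<omega> u \<tau> \<sigma> n z"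
  shows "C_k k (u n) \<and> C_k k (\<tau> n) \<and> C_k k (\<sigma> n)"
proof (induction k arbitrary: n)
  case 0
  have "u n differentiable at z" "\<tau> n differentiable at z" "\<sigma> n differentiable at z" for z
    using R[of n z] has_wirtinger_D(1) unfolding lax_recursion_def by blast+
  then show ?case
    by (auto intro!: continuous_at_imp_continuous_on differentiable_imp_continuous_within)
next
  case (Suc k)
  note R = R[of n, unfolded lax_recursion_def]
  have s: "C_k k E" "C_k k F" "C_k k w" "C_k k w'"
    using smooth_E_F smooth_omega_z[OF smooth_\<omega>] by (simp_all add: smooth_def)
  note intros = C_k_add C_k_diff C_k_mult C_k_const s
    Suc[THEN conjunct1] Suc[THEN conjunct2, THEN conjunct1] Suc[THEN conjunct2, THEN conjunct2]
  have "C_k (Suc k) (u n)"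
    by (rule C_k_SucI'[OF R[THEN conjunct1]]) (intro intros)+
  moreover have "C_k (Suc k) (\<tau> n)"
    by (rule C_k_SucI'[OF R[THEN conjunct2, THEN conjunct1]]) (intro intros)+
  moreover have "C_k (Suc k) (\<sigma> n)"
    by (rule C_k_SucI'[OF R[THEN conjunct2, THEN conjunct2]]) (intro intros)+
  ultimately show ?case by blast
qed

text \<open>In the zbar-derivative of \<open>E z * \<sigma> (n + 1) z\<close> the growth of
  \<open>E\<close> offsets the term with \<open>w'\<close> in the equation for
  \<open>\<sigma> (n + 1)\<close>, so only multiples of \<open>u n\<close> survive.\<close>

lemma lax_recursion_imp_linearized:
  assumes R: "\<And>n z. lax_recursion \<gamma> \<omega> u \<tau> \<sigma> n z"
  shows "linearized_sinh_gordon \<omega> (u n)"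
  unfolding linearized_sinh_gordon_iff
proof (intro conjI allI)
  show "smooth (u n)"
    using lax_recursion_C_k[OF R] by (simp add: smooth_def)
  fix z
  have eq: "dz (u n) = (\<lambda>z. \<i>/4 * (\<gamma> * \<tau> n z - E z * \<sigma> (n + 1) z))"
    using R has_wirtinger_D(4) unfolding lax_recursion_def by blast
  have t: "has_wirtinger (\<tau> n) (- 2 * w z * \<tau> n z + \<i>/2 * u (n + 1) z) (\<i>/2 * cnj \<gamma> * F z * u n z) z"
    and s: "has_wirtinger (\<sigma> (n + 1)) (- \<i>/2 * \<gamma> * F z * u (n + 1) z)
      (- 2 * w' z * \<sigma> (n + 1) z - \<i>/2 * u n z) z"
    using R[of n z] R[of "n + 1" z] by (simp_all add: lax_recursion_def)
  have "dzbar (dz (u n)) z = \<i>/4 * (\<gamma> * (\<i>/2 * cnj \<gamma> * F z * u n z)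
      - (2 * w' z * E z * \<sigma> (n + 1) z + E z * (- 2 * w' z * \<sigma> (n + 1) z - \<i>/2 * u n z)))"
    unfolding eq
    by (rule has_wirtinger_D(5), rule has_wirtinger_cmult, rule has_wirtinger_diff,
        rule has_wirtinger_cmult[OF t], rule has_wirtinger_mult[OF has_wirtinger_E s])
  also have "\<dots> = - (1/8) * ((\<gamma> * cnj \<gamma>) * F z + E z) * u n z"
    by (simp add: field_simps)
  finally show "dzbar (dz (u n)) z = - (1/8) * (E z + F z) * u n z"
    by (simp add: gamma_cnj algebra_simps)
qed

lemma lax_recursion_imp_sinh_gordon:
  assumes shape: "formal_shape u \<tau> \<sigma>" and R: "\<And>n z. lax_recursion \<gamma> \<omega> u \<tau> \<sigma> n z"
  shows "u 0 = w" "sinh_gordon \<omega>"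
proof -
  have m1: "u (-1) = (\<lambda>z. 0)" "\<tau> (-1) = (\<lambda>z. \<i>/4)"
    using shape by (auto simp: formal_shape_def)
  \<comment> \<open>\<open>\<tau> (-1)\<close> and \<open>u (-1)\<close> are constant, so uniqueness
    of the Wirtinger derivatives turns their z-equations into algebraic relations, which determine
    \<open>u 0\<close> and then \<open>\<sigma> 0\<close>.\<close>
  have "has_wirtinger (\<lambda>z. \<i>/4) (- 2 * w z * (\<i>/4) + \<i>/2 * u 0 z) 0 z" for z
    using R[of "-1" z] by (simp add: lax_recursion_def m1)
  then have "- 2 * w z * (\<i>/4) + \<i>/2 * u 0 z = 0" for z
    by (rule has_wirtinger_unique(1)[OF _ has_wirtinger_const])
  then have "u 0 z = w z" for z
    by (simp add: field_simps)
  then show u0: "u 0 = w" by blast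
  have s0: "\<sigma> 0 z = \<i>/4 * \<gamma> * F z" for z
  proof -
    have "has_wirtinger (\<lambda>z. 0) (\<i>/4 * (\<gamma> * (\<i>/4) - E z * \<sigma> 0 z))
        (\<i>/4 * (E z * \<tau> (-2) z - cnj \<gamma> * \<sigma> (-1) z)) z"
      using R[of "-1" z] by (simp add: lax_recursion_def m1)
    then have "\<i>/4 * (\<gamma> * (\<i>/4) - E z * \<sigma> 0 z) = 0"
      by (rule has_wirtinger_unique(1)[OF _ has_wirtinger_const])
    then have "E z * \<sigma> 0 z = \<i>/4 * \<gamma>"
      by (simp add: mult.commute)
    then have "F z * (E z * \<sigma> 0 z) = \<i>/4 * \<gamma> * F z"
      by (simp only: mult_ac)
    moreover have "F z * (E z * \<sigma> 0 z) = (E z * F z) * \<sigma> 0 z"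
      by (simp only: mult_ac)
    ultimately show ?thesis
      by (simp only: E_F mult_1_left)
  qed
  \<comment> \<open>A first order equation suffices: as \<open>u 0\<close> is the z-derivative of
    omega, its zbar-derivative is already a quarter of the Laplacian of omega.\<close>
  have "dzbar (u 0) z = \<i>/4 * (E z * (\<i>/4) - cnj \<gamma> * (\<i>/4 * \<gamma> * F z))" for z
  proof -
    have "dzbar (u 0) z = \<i>/4 * (E z * \<tau> (0 - 1) z - cnj \<gamma> * \<sigma> 0 z)"
      using R[of 0 z] has_wirtinger_D(5) unfolding lax_recursion_def by blast
    then show ?thesis by (simp add: m1 s0)
  qed
  moreover have "\<i>/4 * (E z * (\<i>/4) - cnj \<gamma> * (\<i>/4 * \<gamma> * F z)) = ((cnj \<gamma> * \<gamma>) * F z - E z) / 16" for z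
    by (simp add: field_simps)
  ultimately have "dzbar (u 0) z = ((cnj \<gamma> * \<gamma>) * F z - E z) / 16" for z
    by (rule trans)
  then show "sinh_gordon \<omega>"
    unfolding sinh_gordon_iff[OF smooth_\<omega>] u0 gamma_cnj mult_1_left by blast
qed

end

section \<open>The iteration over a solution of the sinh-Gordon equation\<close>

locale sinh_gordon_solution = unimodular_parameter +
  assumes sinh_gordon_\<omega>: "sinh_gordon \<omega>"
begin

lemma has_wirtinger_w: "has_wirtinger w (dz w z) ((F z - E z) / 16) z"
  using smooth_has_wirtinger[OF smooth_omega_z(1)[OF smooth_\<omega>]] sinh_gordon_\<omega>
  unfolding sinh_gordon_iff[OF smooth_\<omega>] by metis

text \<open>Up to the factor \<open>- 2 * \<i> * cnj \<gamma>\<close> this is the z-derivative that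
  the tau system prescribes.\<close>

definition X :: "(complex \<Rightarrow> complex) \<Rightarrow> complex \<Rightarrow> complex" where
  "X v z = dz (dz v) z - 2 * w z * dz v z"

context
  fixes v assumes lin: "linearized_sinh_gordon \<omega> v"
begin

lemma smooth_v: "smooth v"
  using lin by (simp add: linearized_sinh_gordon_def)

lemma has_wirtinger_v: "has_wirtinger v (dz v z) (dzbar v z) z"
  by (rule smooth_has_wirtinger[OF smooth_v])

lemma has_wirtinger_dz_v: "has_wirtinger (dz v) (dz (dz v) z) (- (1/8) * (E z + F z) * v z) z"
  using smooth_has_wirtinger[OF smooth_dz(1)[OF smooth_v]] lin
  unfolding linearized_sinh_gordon_iff by metis

lemma smooth_X: "smooth (X v)"
  unfolding X_def by (intro smooth_intros smooth_dz smooth_v smooth_omega_z smooth_\<omega>)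

text \<open>Sinh-Gordon for \<open>w\<close> and the linearized equation for v make all terms with
  \<open>E\<close> cancel. What remains is -1/4 times the z-derivative of \<open>F z * v z\<close>,
  and this is the closedness of the tau system.\<close>

lemma has_wirtinger_X: "has_wirtinger (X v) (dz (X v) z) (1/2 * w z * F z * v z - 1/4 * F z * dz v z) z"
proof -
  have "dzbar (dz (dz v)) z = dz (dzbar (dz v)) z"
    by (rule dzbar_dz[OF smooth_dz(1)[OF smooth_v]])
  also have "dzbar (dz v) = (\<lambda>z. - (1/8) * (E z + F z) * v z)"
    using lin by (auto simp: linearized_sinh_gordon_iff)
  also have "dz \<dots> z = - (1/8) * (2 * w z * E z + - 2 * w z * F z) * v z + - (1/8) * (E z + F z) * dz v z"
    by (rule has_wirtinger_D(4), rule has_wirtinger_mult[OF has_wirtinger_cmult has_wirtinger_v],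
        rule has_wirtinger_add[OF has_wirtinger_E has_wirtinger_F])
  finally have "has_wirtinger (dz (dz v)) (dz (dz (dz v)) z)
      (- (1/8) * (2 * w z * E z + - 2 * w z * F z) * v z + - (1/8) * (E z + F z) * dz v z) z"
    using smooth_has_wirtinger[OF smooth_dz(1)[OF smooth_dz(1)[OF smooth_v]]] by metis
  note dzbar_X = has_wirtinger_diff[OF this has_wirtinger_mult[OF has_wirtinger_cmult[OF has_wirtinger_w, of 2] has_wirtinger_dz_v],
      THEN has_wirtinger_D(5)]
  have "dzbar (X v) z = 1/2 * w z * F z * v z - 1/4 * F z * dz v z"
    unfolding X_def[abs_def] dzbar_X by (simp add: field_simps)
  then show ?thesis
    using smooth_has_wirtinger[OF smooth_X] by metis
qed

lemma tau_system_solvable: "\<exists>t. tau_system \<gamma> \<omega> v t"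
proof (rule smooth_wirtinger_system_solvable)
  show "smooth (\<lambda>z. - 2 * \<i> * cnj \<gamma> * X v z)" "smooth (\<lambda>z. \<i>/2 * cnj \<gamma> * F z * v z)"
    by (intro smooth_intros smooth_X smooth_E_F smooth_v)+
  show "dzbar (\<lambda>z. - 2 * \<i> * cnj \<gamma> * X v z) z = dz (\<lambda>z. \<i>/2 * cnj \<gamma> * F z * v z) z" for z
    unfolding has_wirtinger_D(5)[OF has_wirtinger_cmult[OF has_wirtinger_X]]
      has_wirtinger_D(4)[OF has_wirtinger_mult[OF has_wirtinger_cmult[OF has_wirtinger_F] has_wirtinger_v]]
    by (simp add: field_simps)
  fix t
  assume "\<And>z. has_wirtinger t (- 2 * \<i> * cnj \<gamma> * X v z) (\<i>/2 * cnj \<gamma> * F z * v z) z"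
  then show ?thesis
    unfolding tau_system_iff X_def by blast
qed

context
  fixes t assumes tau: "tau_system \<gamma> \<omega> v t"
begin

lemma has_wirtinger_t: "has_wirtinger t (- 2 * \<i> * cnj \<gamma> * X v z) (\<i>/2 * cnj \<gamma> * F z * v z) z"
  using tau unfolding tau_system_iff X_def by blast

lemma smooth_t: "smooth t"
  by (rule smooth_wirtingerI[OF has_wirtinger_t])
    (intro smooth_intros smooth_X smooth_E_F smooth_v)+

lemma next_u_eq: "next_u \<omega> t = (\<lambda>z. - 4 * cnj \<gamma> * X v z - 4 * \<i> * w z * t z)"
  by (auto simp: next_u_def has_wirtinger_D(4)[OF has_wirtinger_t] algebra_simps)

lemma smooth_next_u: "smooth (next_u \<omega> t)"
  unfolding next_u_eq by (intro smooth_intros smooth_X smooth_t smooth_omega_z smooth_\<omega>)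

lemma dzbar_next_u: "dzbar (next_u \<omega> t) z = cnj \<gamma> * F z * dz v z + \<i>/4 * (E z - F z) * t z"
  unfolding next_u_eq
    has_wirtinger_D(5)[OF has_wirtinger_diff[OF has_wirtinger_cmult[OF has_wirtinger_X]
      has_wirtinger_mult[OF has_wirtinger_cmult[OF has_wirtinger_w] has_wirtinger_t]]]
  by (simp add: field_simps)

text \<open>Exchanging the two derivatives allows differentiating the first order formula
  \<open>dzbar_next_u\<close>, in which the derivatives of \<open>X v\<close> no longer
  occur.\<close>

lemma linearized_next_u: "linearized_sinh_gordon \<omega> (next_u \<omega> t)"
  unfolding linearized_sinh_gordon_iff
proof (intro conjI allI smooth_next_u)
  fix z
  have "dzbar (dz (next_u \<omega> t)) z = dz (dzbar (next_u \<omega> t)) z"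
    by (rule dzbar_dz[OF smooth_next_u])
  also have "\<dots> = cnj \<gamma> * (- 2 * w z * F z) * dz v z + cnj \<gamma> * F z * dz (dz v) z
      + (\<i>/4 * (2 * w z * E z - - 2 * w z * F z) * t z + \<i>/4 * (E z - F z) * (- 2 * \<i> * cnj \<gamma> * X v z))"
    unfolding dzbar_next_u
    by (rule has_wirtinger_D(4), rule has_wirtinger_add,
        rule has_wirtinger_mult[OF has_wirtinger_cmult[OF has_wirtinger_F] has_wirtinger_dz_v],
        rule has_wirtinger_mult[OF has_wirtinger_cmult[OF has_wirtinger_diff[OF has_wirtinger_E has_wirtinger_F]]
          has_wirtinger_t])
  also have "\<dots> = - (1/8) * (E z + F z) * next_u \<omega> t z"
    by (simp add: next_u_eq X_def field_simps)
  finally show "dzbar (dz (next_u \<omega> t)) z = - (1/8) * (E z + F z) * next_u \<omega> t z" .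
qed

text \<open>The iteration takes sigma from the zbar-equation of the next u; the right-hand side is
  the value that the z-equation of v demands. The terms \<open>E z * t z\<close> cancel, so both
  equations hold at once.\<close>

lemma next_sigma_eq: "next_sigma \<gamma> \<omega> t (next_u \<omega> t) = (\<lambda>z. F z * (\<gamma> * t z + 4 * \<i> * dz v z))"
proof
  fix z
  have "next_sigma \<gamma> \<omega> t (next_u \<omega> t) z =
      F z * (\<gamma> * t z + 4 * \<i> * ((\<gamma> * cnj \<gamma>) * dz v z))"
    by (simp add: next_sigma_def dzbar_next_u field_simps)
  then show "next_sigma \<gamma> \<omega> t (next_u \<omega> t) z = F z * (\<gamma> * t z + 4 * \<i> * dz v z)"
    by (simp add: gamma_cnj)
qed

text \<open>A step from n to n + 1 yields the z-equation of \<open>u n\<close>, the zbar-equation of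
  \<open>u (n + 1)\<close>, and both equations of \<open>\<tau> n\<close> and of
  \<open>\<sigma> (n + 1)\<close>.\<close>

lemma lax_recursion_step:
  assumes "u' = next_u \<omega> t" "s' = next_sigma \<gamma> \<omega> t u'"
  shows "dz v z = \<i>/4 * (\<gamma> * t z - E z * s' z)"
    "dzbar u' z = \<i>/4 * (E z * t z - cnj \<gamma> * s' z)"
    "has_wirtinger t (- 2 * w z * t z + \<i>/2 * u' z) (\<i>/2 * cnj \<gamma> * F z * v z) z"
    "has_wirtinger s' (- \<i>/2 * \<gamma> * F z * u' z) (- 2 * w' z * s' z - \<i>/2 * v z) z"
proof -
  have s': "s' = (\<lambda>z. F z * (\<gamma> * t z + 4 * \<i> * dz v z))"
    using assms next_sigma_eq by simp
  have "E z * s' z = (E z * F z) * (\<gamma> * t z + 4 * \<i> * dz v z)"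
    unfolding s' by (simp only: mult.assoc)
  then show "dz v z = \<i>/4 * (\<gamma> * t z - E z * s' z)"
    unfolding E_F by (simp add: field_simps)
  have "cnj \<gamma> * s' z = (cnj \<gamma> * \<gamma>) * (E z * t z + 4 * \<i> * dzbar u' z)"
    unfolding assms(2) next_sigma_def by (simp add: algebra_simps)
  then show "dzbar u' z = \<i>/4 * (E z * t z - cnj \<gamma> * s' z)"
    unfolding gamma_cnj by (simp add: field_simps)
  have "- 2 * \<i> * cnj \<gamma> * X v z = - 2 * w z * t z + \<i>/2 * u' z"
    unfolding assms(1) next_u_eq by (simp add: field_simps)
  then show "has_wirtinger t (- 2 * w z * t z + \<i>/2 * u' z) (\<i>/2 * cnj \<gamma> * F z * v z) z"
    using has_wirtinger_t by metis
  have "has_wirtinger s'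
     (- 2 * w z * F z * (\<gamma> * t z + 4 * \<i> * dz v z) +
      F z * (\<gamma> * (- 2 * \<i> * cnj \<gamma> * X v z) + 4 * \<i> * dz (dz v) z))
     (- 2 * w' z * F z * (\<gamma> * t z + 4 * \<i> * dz v z) +
      F z * (\<gamma> * (\<i>/2 * cnj \<gamma> * F z * v z) + 4 * \<i> * (- (1/8) * (E z + F z) * v z))) z"
    unfolding s'
    by (rule has_wirtinger_mult[OF has_wirtinger_F has_wirtinger_add[OF has_wirtinger_cmult[OF has_wirtinger_t]
      has_wirtinger_cmult[OF has_wirtinger_dz_v]]])
  moreover have "- 2 * w z * F z * (\<gamma> * t z + 4 * \<i> * dz v z) +
      F z * (\<gamma> * (- 2 * \<i> * cnj \<gamma> * X v z) + 4 * \<i> * dz (dz v) z) = - \<i>/2 * \<gamma> * F z * u' z"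
  proof -
    have "F z * (\<gamma> * (- 2 * \<i> * cnj \<gamma> * X v z)) = (\<gamma> * cnj \<gamma>) * (- 2 * \<i> * F z * X v z)"
      by (simp only: mult_ac)
    moreover have "- \<i>/2 * \<gamma> * F z * u' z =
        (\<gamma> * cnj \<gamma>) * (2 * \<i> * F z * X v z) - 2 * \<gamma> * F z * w z * t z"
      unfolding assms(1) next_u_eq by (simp add: field_simps)
    ultimately have eqs: "F z * (\<gamma> * (- 2 * \<i> * cnj \<gamma> * X v z)) = - 2 * \<i> * F z * X v z"
      "- \<i>/2 * \<gamma> * F z * u' z = 2 * \<i> * F z * X v z - 2 * \<gamma> * F z * w z * t z"
      by (simp_all only: gamma_cnj mult_1_left)
    show ?thesis
      unfolding eqs distrib_left[of "F z"] by (simp add: X_def algebra_simps)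
  qed
  moreover have "- 2 * w' z * F z * (\<gamma> * t z + 4 * \<i> * dz v z) +
      F z * (\<gamma> * (\<i>/2 * cnj \<gamma> * F z * v z) + 4 * \<i> * (- (1/8) * (E z + F z) * v z)) =
      - 2 * w' z * s' z - \<i>/2 * v z"
  proof -
    have "F z * (\<gamma> * (\<i>/2 * cnj \<gamma> * F z * v z) + 4 * \<i> * (- (1/8) * (E z + F z) * v z)) =
        (\<gamma> * cnj \<gamma>) * (\<i>/2 * F z * F z * v z) - \<i>/2 * (E z * F z) * v z - \<i>/2 * F z * F z * v z"
      by (simp add: field_simps)
    also have "\<dots> = - \<i>/2 * v z"
      unfolding gamma_cnj E_F by simp
    finally show ?thesis
      by (simp add: s' mult.assoc)
  qed
  ultimately show "has_wirtinger s' (- \<i>/2 * \<gamma> * F z * u' z) (- 2 * w' z * s' z - \<i>/2 * v z) z"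
    by metis
qed

lemma tau_system_unique: "tau_system \<gamma> \<omega> v t' \<longleftrightarrow> (\<exists>c. t' = (\<lambda>z. t z + c))"
proof
  assume t': "tau_system \<gamma> \<omega> v t'"
  have "has_wirtinger (\<lambda>z. t' z - t z) 0 0 z" for z
    using has_wirtinger_diff[OF t'[unfolded tau_system_iff, rule_format] tau[unfolded tau_system_iff, rule_format]]
    by simp
  then obtain c where "(\<lambda>z. t' z - t z) = (\<lambda>z. c)"
    using has_wirtinger_0_imp_constant by blast
  then have "t' z = t z + c" for z
    by (metis add.commute diff_add_cancel)
  then show "\<exists>c. t' = (\<lambda>z. t z + c)"
    by blast
next
  assume "\<exists>c. t' = (\<lambda>z. t z + c)"
  then obtain c where c: "t' = (\<lambda>z. t z + c)" by blast
  show "tau_system \<gamma> \<omega> v t'"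
    using tau has_wirtinger_add[OF _ has_wirtinger_const[of c]] unfolding tau_system_iff c by force
qed

lemma next_u_add_const: "next_u \<omega> (\<lambda>z. t z + c) z = next_u \<omega> t z - 4 * \<i> * c * w z"
  using has_wirtinger_D(4)[OF has_wirtinger_add[OF has_wirtinger_t[of z] has_wirtinger_const[of c]]]
    has_wirtinger_D(4)[OF has_wirtinger_t[of z]]
  by (simp add: next_u_def algebra_simps)

end

end

text \<open>At the starting index N no earlier step supplies the zbar-equation of \<open>v N\<close>
  and the equations of \<open>s N\<close>; they enter as hypotheses. For n > N they come from the
  step at n - 1.\<close>

lemma iteration_imp_lax_recursion:
  assumes steps: "\<And>n. n \<ge> N \<Longrightarrow> iteration_step \<gamma> \<omega> v t s n"
    and lin: "linearized_sinh_gordon \<omega> (v N)"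
    and v_N: "\<And>z. dzbar (v N) z = \<i>/4 * (E z * t (N - 1) z - cnj \<gamma> * s N z)"
    and s_N: "\<And>z. has_wirtinger (s N) (- \<i>/2 * \<gamma> * F z * v N z) (- 2 * w' z * s N z - \<i>/2 * v (N - 1) z) z"
    and "n \<ge> N"
  shows "lax_recursion \<gamma> \<omega> v t s n z"
proof -
  have linear: "linearized_sinh_gordon \<omega> (v n)" if "n \<ge> N" for n
    using that
  proof (induction n rule: int_ge_induct)
    case (step n)
    then show ?case
      using steps[of n] linearized_next_u unfolding iteration_step_def by auto
  qed (rule lin)
  have step_data: "tau_system \<gamma> \<omega> (v n) (t n)" "v (n + 1) = next_u \<omega> (t n)"
    "s (n + 1) = next_sigma \<gamma> \<omega> (t n) (v (n + 1))" if "n \<ge> N" for n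
    using steps[OF that] by (simp_all only: iteration_step_def)
  have step:
    "dz (v n) z = \<i>/4 * (\<gamma> * t n z - E z * s (n + 1) z)"
    "dzbar (v (n + 1)) z = \<i>/4 * (E z * t n z - cnj \<gamma> * s (n + 1) z)"
    "has_wirtinger (t n) (- 2 * w z * t n z + \<i>/2 * v (n + 1) z) (\<i>/2 * cnj \<gamma> * F z * v n z) z"
    "has_wirtinger (s (n + 1)) (- \<i>/2 * \<gamma> * F z * v (n + 1) z)
      (- 2 * w' z * s (n + 1) z - \<i>/2 * v n z) z" if "n \<ge> N" for n
    by (rule lax_recursion_step[OF linear[OF that] step_data[OF that]])+
  have "dzbar (v n) z = \<i>/4 * (E z * t (n - 1) z - cnj \<gamma> * s n z) \<and>
    has_wirtinger (s n) (- \<i>/2 * \<gamma> * F z * v n z) (- 2 * w' z * s n z - \<i>/2 * v (n - 1) z) z"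
  proof (cases "n = N")
    case False
    then have "n - 1 \<ge> N" using \<open>n \<ge> N\<close> by simp
    from step(2,4)[OF this] show ?thesis by simp
  qed (simp only: v_N s_N)
  moreover have "v n differentiable at z"
    using linear[OF \<open>n \<ge> N\<close>] smooth_iff unfolding linearized_sinh_gordon_def by blast
  ultimately show ?thesis
    unfolding lax_recursion_def has_wirtinger_iff[of "v n"] using step(1,3)[OF \<open>n \<ge> N\<close>] by blast
qed

text \<open>At index -1 the initial conditions are trivial because v, s and \<open>t (-2)\<close>
  vanish there; the constant \<open>t (-1)\<close>, fixed by the shape, gets the iteration
  going.\<close>

lemma iteration_imp_formal_solution:
  assumes shape: "formal_shape v t s"
    and steps: "\<And>n. n \<ge> -1 \<Longrightarrow> iteration_step \<gamma> \<omega> v t s n"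
  shows "formal_solution \<gamma> \<omega> v t s"
  unfolding formal_solution_iff[OF smooth_\<omega>]
proof (intro conjI allI shape)
  fix n z
  have zero: "v n = (\<lambda>z. 0)" "s n = (\<lambda>z. 0)" if "n < 0" for n
    using shape that by (auto simp: formal_shape_def)
  have zero_t: "t n = (\<lambda>z. 0)" if "n < -1" for n
    using shape that by (auto simp: formal_shape_def)
  have const: "dz (\<lambda>z. 0) z = 0" "dzbar (\<lambda>z. 0) z = 0" for z
    using has_wirtinger_D(4,5)[OF has_wirtinger_const] by auto
  have const': "dz (\<lambda>z. 0) = (\<lambda>z. 0)"
    using const by auto
  show "lax_recursion \<gamma> \<omega> v t s n z"
  proof (cases "n \<ge> -1")
    case True
    show ?thesis
      by (rule iteration_imp_lax_recursion[OF steps _ _ _ True])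
        (simp_all add: zero zero_t linearized_sinh_gordon_iff smooth_const const const' has_wirtinger_const)
  next
    case False
    then show ?thesis
      by (simp add: lax_recursion_def zero zero_t has_wirtinger_const)
  qed
qed

text \<open>Below N the recursion involves v and s up to index N but t only up to N - 1, which is
  just the agreement with the given solution that is assumed. From N on, t may differ from
  \<open>t'\<close>.\<close>

lemma iteration_continues_formal_solution:
  assumes "0 \<le> N" and sol: "formal_solution \<gamma> \<omega> v' t' s'"
    and init: "\<And>n. n \<le> N \<Longrightarrow> v n = v' n \<and> s n = s' n" "\<And>n. n < N \<Longrightarrow> t n = t' n"
    and steps: "\<And>n. n \<ge> N \<Longrightarrow> iteration_step \<gamma> \<omega> v t s n"
  shows "formal_solution \<gamma> \<omega> v t s"
  unfolding formal_solution_iff[OF smooth_\<omega>]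
proof (intro conjI allI)
  have shape: "formal_shape v' t' s'" and R: "\<And>n z. lax_recursion \<gamma> \<omega> v' t' s' n z"
    using sol by (simp_all add: formal_solution_iff[OF smooth_\<omega>])
  show "formal_shape v t s"
    using shape \<open>0 \<le> N\<close> init by (simp add: formal_shape_def)
  fix n z
  show "lax_recursion \<gamma> \<omega> v t s n z"
  proof (cases "n \<ge> N")
    case True
    show ?thesis
    proof (rule iteration_imp_lax_recursion[OF steps _ _ _ True])
      show "linearized_sinh_gordon \<omega> (v N)"
        using lax_recursion_imp_linearized[OF R] init(1) by simp
      fix z
      show "dzbar (v N) z = \<i>/4 * (E z * t (N - 1) z - cnj \<gamma> * s N z)"
        "has_wirtinger (s N) (- \<i>/2 * \<gamma> * F z * v N z) (- 2 * w' z * s N z - \<i>/2 * v (N - 1) z) z"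
        using R[of N z] init has_wirtinger_D(5) by (auto simp: lax_recursion_def)
    qed
  next
    case False
    then show ?thesis
      using R[of n z] init by (simp add: lax_recursion_def)
  qed
qed

end

section \<open>Truncation at the top index and the adjoint solution\<close>

context unimodular_parameter
begin

text \<open>
  Two expressions for the antiholomorphic derivative of the last coefficient of the lower left
  entry have opposite signs, so this coefficient is constant.
\<close>

lemma polynomial_top_coeff:
  assumes shape: "polynomial_shape g u \<tau> \<sigma>" and R: "\<And>n z. lax_recursion \<gamma> \<omega> u \<tau> \<sigma> n z"
  shows "\<exists>c. \<forall>z. u (int g - 1) z = c * w' z"
proof -
  let ?g = "int g"
  have above: "u (?g + 1) = (\<lambda>z. 0)" "\<sigma> (?g + 1) = (\<lambda>z. 0)"
    using shape by (simp_all add: polynomial_shape_def)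
  \<comment> \<open>The zbar-equations carry the zeros downwards: that of \<open>u (g + 1)\<close>
    gives \<open>\<tau> g = 0\<close>, that of \<open>\<tau> g\<close> gives \<open>u g = 0\<close>,
    and that of \<open>u g\<close> expresses \<open>\<sigma> g\<close> by
    \<open>\<tau> (g - 1)\<close>.\<close>
  have "\<tau> ?g z = 0" for z
    using R[of "?g + 1" z] has_wirtinger_unique(2)[OF has_wirtinger_const[of 0]]
    unfolding lax_recursion_def above by fastforce
  then have t: "\<tau> ?g = (\<lambda>z. 0)" by blast
  have "u ?g z = 0" for z
    using R[of ?g z] has_wirtinger_unique(2)[OF has_wirtinger_const[of 0]] norm_\<gamma>
    unfolding lax_recursion_def t by fastforce
  then have u: "u ?g = (\<lambda>z. 0)" by blast
  have s: "\<sigma> ?g = (\<lambda>z. \<gamma> * E z * \<tau> (?g - 1) z)"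
  proof
    fix z
    have "0 = \<i>/4 * (E z * \<tau> (?g - 1) z - cnj \<gamma> * \<sigma> ?g z)"
      using R[of ?g z] has_wirtinger_unique(2)[OF has_wirtinger_const[of 0]]
      unfolding lax_recursion_def u by blast
    then have "E z * \<tau> (?g - 1) z = cnj \<gamma> * \<sigma> ?g z"
      by simp
    then have "\<gamma> * E z * \<tau> (?g - 1) z = (\<gamma> * cnj \<gamma>) * \<sigma> ?g z"
      by (simp add: mult.assoc)
    then show "\<sigma> ?g z = \<gamma> * E z * \<tau> (?g - 1) z"
      by (simp add: gamma_cnj)
  qed
  \<comment> \<open>\<open>s1\<close> is the recursion for \<open>\<sigma> g\<close>, whose
    z-derivative is zero because \<open>u g\<close> is; \<open>s2\<close> is the product rule for
    \<open>\<gamma> * E z * \<tau> (g - 1) z\<close>.\<close>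
  have s1: "has_wirtinger (\<sigma> ?g) 0 (- 2 * w' z * \<sigma> ?g z - \<i>/2 * u (?g - 1) z) z" for z
    using R[of ?g z] by (simp add: lax_recursion_def u)
  have s2: "dzbar (\<sigma> ?g) z = 2 * w' z * \<sigma> ?g z + \<i>/2 * u (?g - 1) z" for z
  proof -
    have "has_wirtinger (\<tau> (?g - 1)) (- 2 * w z * \<tau> (?g - 1) z + \<i>/2 * u ?g z)
        (\<i>/2 * cnj \<gamma> * F z * u (?g - 1) z) z"
      using R[of "?g - 1" z] by (simp add: lax_recursion_def)
    from has_wirtinger_D(5)[OF has_wirtinger_mult[OF has_wirtinger_cmult[OF has_wirtinger_E] this]]
    have "dzbar (\<sigma> ?g) z = 2 * w' z * \<sigma> ?g z + \<i>/2 * (\<gamma> * cnj \<gamma>) * (E z * F z) * u (?g - 1) z"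
      unfolding s by (simp add: algebra_simps)
    then show ?thesis
      by (simp only: gamma_cnj E_F mult_1_right)
  qed
  have zero: "2 * w' z * \<sigma> ?g z + \<i>/2 * u (?g - 1) z = 0" for z
  proof -
    have "2 * (2 * w' z * \<sigma> ?g z + \<i>/2 * u (?g - 1) z) =
        (2 * w' z * \<sigma> ?g z + \<i>/2 * u (?g - 1) z) - (- 2 * w' z * \<sigma> ?g z - \<i>/2 * u (?g - 1) z)"
      by simp
    also have "\<dots> = 0"
      unfolding s2[symmetric] has_wirtinger_D(5)[OF s1, symmetric] by simp
    finally show ?thesis
      by (simp only: mult_eq_0_iff) simp
  qed
  have "has_wirtinger (\<sigma> ?g) 0 0 z" for z
    using has_wirtinger_D(1,4)[OF s1[of z]] s2[of z] zero[of z] by (simp add: has_wirtinger_iff)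
  then obtain c where c: "\<sigma> ?g = (\<lambda>z. c)"
    using has_wirtinger_0_imp_constant by blast
  have "u (?g - 1) z = 4 * \<i> * c * w' z" for z
    using zero[of z] unfolding c by (simp add: field_simps complex_eq_iff)
  then show ?thesis by blast
qed

end

text \<open>The form satisfies alpha(1 / cnj l)* = - alpha(l), where * is the conjugate transpose.\<close>

lemma lax_solution_adjoint:
  assumes \<omega>: "smooth \<omega>" and lax: "lax_solution \<gamma> \<omega> \<Phi>"
  shows "lax_solution \<gamma> \<omega> (\<lambda>l z. cscale (l ^ g) (transpose (map_matrix cnj (\<Phi> (1 / cnj l) z))))"
  unfolding lax_solution_def
proof (intro allI impI)
  fix l z :: complex assume l: "l \<noteq> 0"
  let ?k = "1 / cnj l"
  let ?A = "\<lambda>M. cscale (l ^ g) (transpose (map_matrix cnj M))"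
  have entry: "?A M $ i $ j = l ^ g * cnj (M $ j $ i)" for M i j
    by (simp add: cscale_def transpose_def map_matrix_def)
  have "linear ?A"
    by (rule linearI) (simp_all add: vec_eq_iff forall_2 entry algebra_simps)
  then have bl: "bounded_linear ?A"
    by (simp add: linear_conv_bounded_linear)
  have cnj_simps: "cnj (omega_z \<omega> z) = omega_zbar \<omega> z" "cnj (omega_zbar \<omega> z) = omega_z \<omega> z"
    "cnj (e_pow x) = e_pow x" for x
    by (simp_all add: e_pow_def flip: cnj_omega_z[OF \<omega>])
  have "\<forall>i j. cnj (alpha \<gamma> \<omega> ?k z h $ j $ i) = - alpha \<gamma> \<omega> l z h $ i $ j" for h
    using l by (simp add: forall_2 alpha_eq_mat2 cnj_simps field_simps)
  then have alpha_adjoint: "cnj (alpha \<gamma> \<omega> ?k z h $ j $ i) = - alpha \<gamma> \<omega> l z h $ i $ j" for h i j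
    by blast
  \<comment> \<open>Taking adjoints reverses products and so negates the commutator; the sign in
    \<open>alpha_adjoint\<close> compensates for this.\<close>
  have comm: "?A (commutator (\<Phi> ?k z) (alpha \<gamma> \<omega> ?k z h)) = commutator (?A (\<Phi> ?k z)) (alpha \<gamma> \<omega> l z h)" for h
    by (simp only: vec_eq_iff entry commutator_def vector_minus_component matrix_matrix_mult_def
        vec_lambda_beta sum_2 complex_cnj_diff complex_cnj_add complex_cnj_mult alpha_adjoint)
      (simp add: algebra_simps)
  have "(\<Phi> ?k has_derivative (\<lambda>h. commutator (\<Phi> ?k z) (alpha \<gamma> \<omega> ?k z h))) (at z)"
    using lax l by (simp add: lax_solution_def)
  from bounded_linear.has_derivative[OF bl this]
  show "((\<lambda>z. ?A (\<Phi> ?k z)) has_derivative (\<lambda>h. commutator (?A (\<Phi> ?k z)) (alpha \<gamma> \<omega> l z h))) (at z)"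
    unfolding comm .
qed

theorem proposition2p2:
  fixes \<omega> :: "complex \<Rightarrow> real" and g :: nat and \<gamma> :: complex
    and u \<tau> \<sigma> :: "int \<Rightarrow> complex \<Rightarrow> complex"
  assumes "smooth \<omega>"
    and "norm \<gamma> = 1"
    and "polynomial_shape g u \<tau> \<sigma>"
    and "lax_solution \<gamma> \<omega> (Phi g \<omega> u \<tau> \<sigma>)"
  shows
    "\<comment> \<open>(1)\<close>
    sinh_gordon \<omega> \<and>
    \<comment> \<open>(2)\<close>
    (\<forall>n. linearized_sinh_gordon \<omega> (u n)) \<and>
    \<comment> \<open>(3): each step can be carried out and produces an admissible input for the next one\<close>
    (\<forall>v. linearized_sinh_gordon \<omega> v \<longrightarrow>
       (\<exists>t. tau_system \<gamma> \<omega> v t) \<and>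
       (\<forall>t. tau_system \<gamma> \<omega> v t \<longrightarrow> linearized_sinh_gordon \<omega> (next_u \<omega> t))) \<and>
    \<comment> \<open>(3): started at index -1 the iteration yields a formal solution\<close>
    (\<forall>v t s. formal_shape v t s \<and> (\<forall>n\<ge>-1. iteration_step \<gamma> \<omega> v t s n) \<longrightarrow>
       formal_solution \<gamma> \<omega> v t s) \<and>
    \<comment> \<open>(3): so does the iteration started at index N with initial data taken from a formal solution\<close>
    (\<forall>N\<ge>0. \<forall>v' t' s' v t s.
       formal_solution \<gamma> \<omega> v' t' s' \<and>
       (\<forall>n\<le>N. v n = v' n \<and> s n = s' n) \<and> (\<forall>n<N. t n = t' n) \<and>
       (\<forall>n\<ge>N. iteration_step \<gamma> \<omega> v t s n) \<longrightarrow>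
       formal_solution \<gamma> \<omega> v t s) \<and>
    \<comment> \<open>(4)\<close>
    (\<forall>v t. linearized_sinh_gordon \<omega> v \<and> tau_system \<gamma> \<omega> v t \<longrightarrow>
       (\<forall>t'. tau_system \<gamma> \<omega> v t' \<longleftrightarrow> (\<exists>c. t' = (\<lambda>z. t z + c))) \<and>
       (\<forall>c z. next_u \<omega> (\<lambda>z. t z + c) z = next_u \<omega> t z - 4 * \<i> * c * omega_z \<omega> z)) \<and>
    \<comment> \<open>(5)\<close>
    u 0 = omega_z \<omega> \<and>
    (\<exists>c. \<forall>z. u (int g - 1) z = c * omega_zbar \<omega> z) \<and>
    lax_solution \<gamma> \<omega>
      (\<lambda>l z. cscale (l ^ g) (transpose (map_matrix cnj (Phi g \<omega> u \<tau> \<sigma> (1 / cnj l) z))))"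
proof -
  have formal: "formal_solution \<gamma> \<omega> u \<tau> \<sigma>"
    by (rule lax_solution_imp_formal_solution[OF assms(1,3,4)])
  then have shape: "formal_shape u \<tau> \<sigma>" and R: "\<And>n z. lax_recursion \<gamma> \<omega> u \<tau> \<sigma> n z"
    by (simp_all add: formal_solution_iff[OF assms(1)])
  interpret unimodular_parameter \<omega> \<gamma>
    by unfold_locales (rule assms)+
  note sg = lax_recursion_imp_sinh_gordon[OF shape R]
  \<comment> \<open>Only now, with sinh-Gordon derived from the given polynomial solution, are the
    facts about the iteration available.\<close>
  interpret sinh_gordon_solution \<omega> \<gamma>
    by unfold_locales (rule sg)
  show ?thesis
  proof (intro conjI)
    show "\<forall>v. linearized_sinh_gordon \<omega> v \<longrightarrow>
       (\<exists>t. tau_system \<gamma> \<omega> v t) \<and>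
       (\<forall>t. tau_system \<gamma> \<omega> v t \<longrightarrow> linearized_sinh_gordon \<omega> (next_u \<omega> t))"
      using tau_system_solvable linearized_next_u by blast
    show "\<forall>v t s. formal_shape v t s \<and> (\<forall>n\<ge>-1. iteration_step \<gamma> \<omega> v t s n) \<longrightarrow>
       formal_solution \<gamma> \<omega> v t s"
      using iteration_imp_formal_solution by blast
    show "\<forall>N\<ge>0. \<forall>v' t' s' v t s.
       formal_solution \<gamma> \<omega> v' t' s' \<and>
       (\<forall>n\<le>N. v n = v' n \<and> s n = s' n) \<and> (\<forall>n<N. t n = t' n) \<and>
       (\<forall>n\<ge>N. iteration_step \<gamma> \<omega> v t s n) \<longrightarrow>
       formal_solution \<gamma> \<omega> v t s"
    proof (intro allI impI; elim conjE)
      fix N :: int and v' t' s' v t s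
      assume "0 \<le> N" "formal_solution \<gamma> \<omega> v' t' s'" "\<forall>n\<le>N. v n = v' n \<and> s n = s' n"
        "\<forall>n<N. t n = t' n" "\<forall>n\<ge>N. iteration_step \<gamma> \<omega> v t s n"
      then show "formal_solution \<gamma> \<omega> v t s"
        by (intro iteration_continues_formal_solution[of N v' t' s' v s t]) simp_all
    qed
    show "\<forall>v t. linearized_sinh_gordon \<omega> v \<and> tau_system \<gamma> \<omega> v t \<longrightarrow>
       (\<forall>t'. tau_system \<gamma> \<omega> v t' \<longleftrightarrow> (\<exists>c. t' = (\<lambda>z. t z + c))) \<and>
       (\<forall>c z. next_u \<omega> (\<lambda>z. t z + c) z = next_u \<omega> t z - 4 * \<i> * c * omega_z \<omega> z)"
      using tau_system_unique next_u_add_const by blast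
    show "sinh_gordon \<omega>" "u 0 = omega_z \<omega>"
      by (rule sg)+
    show "\<forall>n. linearized_sinh_gordon \<omega> (u n)"
      using lax_recursion_imp_linearized[OF R] ..
    show "\<exists>c. \<forall>z. u (int g - 1) z = c * omega_zbar \<omega> z"
      by (rule polynomial_top_coeff[OF assms(3) R])
    show "lax_solution \<gamma> \<omega>
      (\<lambda>l z. cscale (l ^ g) (transpose (map_matrix cnj (Phi g \<omega> u \<tau> \<sigma> (1 / cnj l) z))))"
      by (rule lax_solution_adjoint[OF assms(1,4)])
  qed
qed

end
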